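(* Let $\mathtt{Tr}$ be the trace of a transient BRW on a unimodular random graph. Then almost surely $p_c(\mathtt{Tr})<1$, where $p_c$ denotes the critical probability for Bernoulli bond percolation.
   Context: Graphs are infinite, connected, with uniformly bounded degrees. BRW: offspring law $(p_k)$ with $p_0=0$, $p_1<1$; it is the tree-indexed SRW $(S_v)_{v\in\mathbb{T}}$ over a Galton–Watson family tree $\mathbb{T}$ with $S_{\mathbf r}=o$, steps of SRW ($p(x,y)=1/\deg(x)$ for $x\sim y$) independent along edges of $\mathbb{T}$. Transient: every vertex is visited by only finitely many particles a.s. Trace $\mathtt{Tr}$: subgraph of $G$ with vertices $\{S_v\}$ and edges $\{\{S_{v^-},S_v\}\}$. URG: random rooted graph whose law $\mu$ on rooted isomorphism classes satisfies $\int\sum_x f(G,o,x)d\mu=\int\sum_x f(G,x,o)d\mu$ for all Borel $f\ge0$. For a locally finite graph $H$, Bernoulli($p$) bond percolation keeps each edge independently with probability $p$; $p_c(H)=\sup\{p:\ \mathbf P_p(\exists\text{ an infinite connected component})=0\}$. *)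

theory Defs
  imports "HOL-Probability.Probability"
begin

section \<open>Rooted labelled graphs\<close>

text \<open>A graph is an adjacency predicate on the vertex set nat (pairs), the root is 0.\<close>
type_synonym graph = "nat \<times> nat \<Rightarrow> bool"

definition nbrs :: "graph \<Rightarrow> nat \<Rightarrow> nat set" where
  "nbrs G x = {y. G (x, y)}"

definition edge_rel :: "graph \<Rightarrow> (nat \<times> nat) set" where
  "edge_rel G = {(a, b). G (a, b)}"

text \<open>Infinite (vertex set is all of nat), connected, simple, degrees bounded by D.\<close>
definition bounded_degree_graph :: "nat \<Rightarrow> graph \<Rightarrow> bool" where
  "bounded_degree_graph D G \<longleftrightarrow>
     (\<forall>x y. G (x, y) \<longrightarrow> G (y, x)) \<and> (\<forall>x. \<not> G (x, x)) \<and>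
     (\<forall>x y. (x, y) \<in> (edge_rel G)\<^sup>*) \<and>
     (\<forall>x. finite (nbrs G x) \<and> card (nbrs G x) \<le> D)"

definition graph_space :: "graph measure" where
  "graph_space = PiM UNIV (\<lambda>_. count_space UNIV)"

definition relabel :: "(nat \<Rightarrow> nat) \<Rightarrow> graph \<Rightarrow> graph" where
  "relabel \<pi> G = (\<lambda>(x, y). G (inv \<pi> x, inv \<pi> y))"

definition iso_invariant :: "(graph \<times> nat \<times> nat \<Rightarrow> ennreal) \<Rightarrow> bool" where
  "iso_invariant f \<longleftrightarrow>
     (\<forall>\<pi> G a b. bij \<pi> \<longrightarrow> f (relabel \<pi> G, \<pi> a, \<pi> b) = f (G, a, b))"

text \<open>Mass transport principle (unimodularity), root = 0.\<close>
definition unimodular :: "graph measure \<Rightarrow> bool" where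
  "unimodular \<mu> \<longleftrightarrow>
     (\<forall>f. f \<in> borel_measurable (graph_space \<Otimes>\<^sub>M (count_space UNIV \<Otimes>\<^sub>M count_space UNIV))
        \<longrightarrow> iso_invariant f
        \<longrightarrow> (\<integral>\<^sup>+ G. (\<Sum>x. f (G, 0, x)) \<partial>\<mu>) = (\<integral>\<^sup>+ G. (\<Sum>x. f (G, x, 0)) \<partial>\<mu>))"

section \<open>Branching random walk\<close>

text \<open>Ulam--Harris labels: children of w are i # w. Each label v carries
  (number of children of v, uniform [0,1) variable driving the SRW step into v).\<close>
type_synonym brw_sample = "nat list \<Rightarrow> nat \<times> real"

definition brw_space :: "nat pmf \<Rightarrow> brw_sample measure" where
  "brw_space p = PiM UNIV (\<lambda>_. measure_pmf p \<Otimes>\<^sub>M uniform_measure lborel {0..<1})"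

inductive_set gw_tree :: "brw_sample \<Rightarrow> nat list set" for \<omega> where
  root: "[] \<in> gw_tree \<omega>"
| child: "w \<in> gw_tree \<omega> \<Longrightarrow> i < fst (\<omega> w) \<Longrightarrow> i # w \<in> gw_tree \<omega>"

text \<open>Uniform choice of a neighbour of x driven by u \<in> [0,1).\<close>
definition srw_step :: "graph \<Rightarrow> nat \<Rightarrow> real \<Rightarrow> nat" where
  "srw_step G x u = sorted_list_of_set (nbrs G x) ! nat \<lfloor>u * real (card (nbrs G x))\<rfloor>"

fun brw_pos :: "graph \<Rightarrow> brw_sample \<Rightarrow> nat list \<Rightarrow> nat" where
  "brw_pos G \<omega> [] = 0"
| "brw_pos G \<omega> (i # w) = srw_step G (brw_pos G \<omega> w) (snd (\<omega> (i # w)))"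

definition transient_sample :: "graph \<Rightarrow> brw_sample \<Rightarrow> bool" where
  "transient_sample G \<omega> \<longleftrightarrow> (\<forall>x. finite {v \<in> gw_tree \<omega>. brw_pos G \<omega> v = x})"

text \<open>The trace as a graph (edge set {S_{v^-}, S_v}).\<close>
definition trace :: "graph \<Rightarrow> brw_sample \<Rightarrow> graph" where
  "trace G \<omega> = (\<lambda>(x, y). \<exists>i w. i # w \<in> gw_tree \<omega> \<and>
      ((brw_pos G \<omega> w = x \<and> brw_pos G \<omega> (i # w) = y) \<or>
       (brw_pos G \<omega> w = y \<and> brw_pos G \<omega> (i # w) = x)))"

section \<open>Bernoulli bond percolation\<close>

definition perc_space :: "real \<Rightarrow> (nat \<times> nat \<Rightarrow> bool) measure" where
  "perc_space q = PiM UNIV (\<lambda>_. measure_pmf (bernoulli_pmf q))"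

text \<open>Edge {x,y} of H is open iff the coin at (min x y, max x y) is heads.\<close>
definition open_edges :: "graph \<Rightarrow> (nat \<times> nat \<Rightarrow> bool) \<Rightarrow> (nat \<times> nat) set" where
  "open_edges H \<eta> = {(x, y). H (x, y) \<and> \<eta> (min x y, max x y)}"

definition perc_event :: "graph \<Rightarrow> (nat \<times> nat \<Rightarrow> bool) set" where
  "perc_event H = {\<eta>. \<exists>x. infinite {y. (x, y) \<in> (open_edges H \<eta>)\<^sup>*}}"

definition p_c :: "graph \<Rightarrow> real" where
  "p_c H = Sup {q \<in> {0..1}. measure (perc_space q) (perc_event H) = 0}"

end

theory Submission
  imports Defs
begin

text \<open>
  Open each edge of the graph with probability \<open>q\<close>, put \<open>r = 1 - p\<^sub>1\<close> and let \<open>P\<close> be the walk killed at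
  closed edges. A particle has at least two children with probability \<open>r\<close>, so from the quenched
  probabilities \<open>s\<close> of an open line of \<open>n\<close> descendants one gets at least \<open>\<phi> (P s)\<close> for \<open>n + 1\<close>
  descendants, where \<open>\<phi> t = t + r t (1 - t)\<close>. The mass transport principle makes \<open>P\<close> self-adjoint
  in the degree-weighted \<open>L\<^sup>2\<close> of the environment seen from the root. With \<open>\<Phi>' = \<phi>\<close> and
  \<open>s\<^sub>n = \<phi> (t\<^sub>n)\<close>, \<open>t\<^sub>n\<^sub>+\<^sub>1 = P s\<^sub>n\<close>, self-adjointness and the convexity of \<open>\<Phi>\<close> show that the energy
  \<open>\<integral> deg (\<Phi> (t\<^sub>n\<^sub>+\<^sub>1) + \<Phi> (t\<^sub>n) - s\<^sub>n t\<^sub>n)\<close> does not decrease in \<open>n\<close>. It is positive at the start when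
  \<open>1 - q < r / 3\<close>, so \<open>s\<^sub>n\<close> cannot tend to \<open>0\<close>. By transience an infinite open line of descent makes the
  trace percolate.

  To obtain this almost surely rather than with positive probability, bound the probability that the
  trace percolates from below by an increasing iteration whose limit is, by stationarity, \<open>0\<close> or \<open>1\<close> at
  the root and its neighbours alike, and run the energy argument on the set where the limit is \<open>0\<close>.
\<close>

section \<open>Infinite products of a probability space\<close>

lemma prob_space_PiM_UNIV:
  "prob_space M \<Longrightarrow> prob_space (PiM (UNIV::'i set) (\<lambda>_. M))"
  by (intro prob_space_PiM) auto

text \<open>Cylinders over finitely many coordinates generate the product sigma-algebra and are
  stable under intersection, so comparing their probabilities suffices. Both the coordinatewise
  image and the gluing of two samples below are treated this way.\<close>

lemma distr_eq_PiM_UNIV: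
  fixes M :: "'a measure" and T :: "'b \<Rightarrow> 'i \<Rightarrow> 'a"
  assumes M: "prob_space M" and T: "T \<in> N \<rightarrow>\<^sub>M PiM UNIV (\<lambda>_. M)"
    and eq: "\<And>J F. finite J \<Longrightarrow> (\<And>j. j \<in> J \<Longrightarrow> F j \<in> sets M) \<Longrightarrow>
      emeasure N {x \<in> space N. \<forall>j\<in>J. T x j \<in> F j} = (\<Prod>j\<in>J. emeasure M (F j))"
  shows "distr N (PiM UNIV (\<lambda>_. M)) T = PiM UNIV (\<lambda>_. M)"
proof -
  interpret product_prob_space "\<lambda>_. M" "UNIV :: 'i set"
    using M by (intro product_prob_spaceI)
  show ?thesis
  proof (rule PiM_eq)
    fix J :: "'i set" and F assume J: "finite J" "J \<subseteq> UNIV" and F: "\<And>j. j \<in> J \<Longrightarrow> F j \<in> sets M"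
    have "T -` prod_emb UNIV (\<lambda>_. M) J (Pi\<^sub>E J F) \<inter> space N = {x \<in> space N. \<forall>j\<in>J. T x j \<in> F j}"
      using measurable_space[OF T] by (auto simp: prod_emb_def space_PiM restrict_PiE_iff PiE_iff)
    then show "emeasure (distr N (PiM UNIV (\<lambda>_. M)) T) (prod_emb UNIV (\<lambda>_. M) J (Pi\<^sub>E J F))
        = (\<Prod>j\<in>J. emeasure M (F j))"
      using J F T by (subst emeasure_distr) (auto simp: eq intro!: sets_PiM_I)
  qed simp
qed

lemma emeasure_PiM_UNIV_Collect:
  fixes M :: "'a measure" and J :: "'i set"
  assumes M: "prob_space M" and "finite J" "\<And>j. j \<in> J \<Longrightarrow> F j \<in> sets M"
  shows "emeasure (PiM UNIV (\<lambda>_. M)) {x \<in> space (PiM UNIV (\<lambda>_. M)). \<forall>j\<in>J. x j \<in> F j}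
     = (\<Prod>j\<in>J. emeasure M (F j))"
proof -
  interpret product_prob_space "\<lambda>_. M" "UNIV :: 'i set"
    using M by (intro product_prob_spaceI)
  show ?thesis
    using assms by (intro emeasure_PiM_Collect) auto
qed

lemma distr_PiM_UNIV_map:
  fixes M :: "'a measure"
  assumes M: "prob_space M" and f: "f \<in> M \<rightarrow>\<^sub>M N"
  shows "distr (PiM (UNIV::'i set) (\<lambda>_. M)) (PiM UNIV (\<lambda>_. distr M N f)) (\<lambda>\<omega> i. f (\<omega> i))
    = PiM UNIV (\<lambda>_. distr M N f)"
proof (rule distr_eq_PiM_UNIV)
  show "prob_space (distr M N f)"
    using M f by (rule prob_space.prob_space_distr)
  show "(\<lambda>\<omega> i. f (\<omega> i)) \<in> PiM UNIV (\<lambda>_. M) \<rightarrow>\<^sub>M PiM UNIV (\<lambda>_. distr M N f)"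
    using f by (intro measurable_PiM_single') (auto simp: space_PiM dest: measurable_space)
  fix J :: "'i set" and F assume J: "finite J" and F: "\<And>j. j \<in> J \<Longrightarrow> F j \<in> sets (distr M N f)"
  have "{x \<in> space (PiM UNIV (\<lambda>_. M)). \<forall>j\<in>J. f (x j) \<in> F j}
    = {x \<in> space (PiM UNIV (\<lambda>_. M)). \<forall>j\<in>J. x j \<in> f -` F j \<inter> space M}"
    by (auto simp: space_PiM)
  then show "emeasure (PiM UNIV (\<lambda>_. M)) {x \<in> space (PiM UNIV (\<lambda>_. M)). \<forall>j\<in>J. f (x j) \<in> F j}
    = (\<Prod>j\<in>J. emeasure (distr M N f) (F j))"
    using emeasure_PiM_UNIV_Collect[OF M J, of "\<lambda>j. f -` F j \<inter> space M"] F f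
    by (simp add: emeasure_distr measurable_sets)
qed

lemma distr_PiM_UNIV_reindex:
  fixes M :: "'a measure" and f :: "'i \<Rightarrow> 'j"
  assumes M: "prob_space M" and "inj f"
  shows "distr (PiM UNIV (\<lambda>_. M)) (PiM UNIV (\<lambda>_. M)) (\<lambda>\<omega> i. \<omega> (f i)) = PiM UNIV (\<lambda>_. M)"
  using distr_PiM_reindex[of UNIV "\<lambda>_. M" f UNIV] assms by (simp add: restrict_def)

text \<open>Gluing two independent samples along \<open>S\<close> gives a sample with the same law
  (\<open>distr_splice\<close>); this turns independence of disjoint blocks of coordinates into the
  product formula for a rectangle.\<close>

definition splice :: "'i set \<Rightarrow> ('i \<Rightarrow> 'a) \<Rightarrow> ('i \<Rightarrow> 'a) \<Rightarrow> 'i \<Rightarrow> 'a" where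
  "splice S \<omega> \<omega>' = (\<lambda>i. if i \<in> S then \<omega> i else \<omega>' i)"

lemma measurable_splice:
  "(\<lambda>(\<omega>, \<omega>'). splice S \<omega> \<omega>') \<in> PiM UNIV (\<lambda>_. M) \<Otimes>\<^sub>M PiM UNIV (\<lambda>_. M) \<rightarrow>\<^sub>M PiM UNIV (\<lambda>_. M)"
  unfolding splice_def by (rule measurable_PiM_single') (auto simp: space_PiM space_pair_measure split_beta PiE_iff)

lemma distr_splice:
  fixes M :: "'a measure" and S :: "'i set"
  assumes M: "prob_space M"
  defines "P \<equiv> PiM UNIV (\<lambda>_. M)"
  shows "distr (P \<Otimes>\<^sub>M P) P (\<lambda>(\<omega>, \<omega>'). splice S \<omega> \<omega>') = P"
  unfolding P_def
proof (rule distr_eq_PiM_UNIV[OF M measurable_splice])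
  fix J :: "'i set" and F assume J: "finite J" and F: "\<And>j. j \<in> J \<Longrightarrow> F j \<in> sets M"
  interpret P: prob_space P
    unfolding P_def using M by (rule prob_space_PiM_UNIV)
  let ?A = "{x \<in> space P. \<forall>j\<in>J\<inter>S. x j \<in> F j}" and ?B = "{x \<in> space P. \<forall>j\<in>J-S. x j \<in> F j}"
  have [measurable]: "?A \<in> sets P" "?B \<in> sets P"
    unfolding P_def using J F by (auto intro!: sets.sets_Collect_finite_All' sets_Collect_single')
  have "{x \<in> space (P \<Otimes>\<^sub>M P). \<forall>j\<in>J. (case x of (\<omega>, \<omega>') \<Rightarrow> splice S \<omega> \<omega>') j \<in> F j} = ?A \<times> ?B"
    by (auto simp: space_pair_measure splice_def split: if_splits)
  then have "emeasure (P \<Otimes>\<^sub>M P) {x \<in> space (P \<Otimes>\<^sub>M P). \<forall>j\<in>J. (case x of (\<omega>, \<omega>') \<Rightarrow> splice S \<omega> \<omega>') j \<in> F j}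
     = emeasure P ?A * emeasure P ?B"
    by (simp add: P.emeasure_pair_measure_Times)
  also have "\<dots> = (\<Prod>j\<in>J\<inter>S. emeasure M (F j)) * (\<Prod>j\<in>J-S. emeasure M (F j))"
    unfolding P_def using J F
    by (intro arg_cong2[where f = "(*)"] emeasure_PiM_UNIV_Collect[OF M]) auto
  also have "\<dots> = (\<Prod>j\<in>J. emeasure M (F j))"
    using J by (metis prod.Int_Diff)
  finally show "emeasure (PiM UNIV (\<lambda>_. M) \<Otimes>\<^sub>M PiM UNIV (\<lambda>_. M))
     {x \<in> space (PiM UNIV (\<lambda>_. M) \<Otimes>\<^sub>M PiM UNIV (\<lambda>_. M)). \<forall>j\<in>J. (case x of (\<omega>, \<omega>') \<Rightarrow> splice S \<omega> \<omega>') j \<in> F j}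
     = (\<Prod>j\<in>J. emeasure M (F j))"
    unfolding P_def .
qed

definition determined_by :: "'i set \<Rightarrow> ('i \<Rightarrow> 'a) set \<Rightarrow> bool" where
  "determined_by S A \<longleftrightarrow> (\<forall>\<omega> \<omega>'. (\<forall>i\<in>S. \<omega> i = \<omega>' i) \<longrightarrow> \<omega> \<in> A \<longleftrightarrow> \<omega>' \<in> A)"

text \<open>\<open>A\<close> constrains only the first of the two glued samples and \<open>B\<close>
  only the second, so the preimage of \<open>A \<inter> B\<close> under the gluing is the rectangle
  \<open>A \<times> B\<close>.\<close>

lemma measure_Int_determined_by:
  fixes M :: "'a measure" and A B :: "('i \<Rightarrow> 'a) set"
  defines "P \<equiv> PiM UNIV (\<lambda>_. M)"
  assumes M: "prob_space M" and A: "A \<in> sets P" "determined_by S A"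
    and B: "B \<in> sets P" "determined_by (- S) B"
  shows "measure P (A \<inter> B) = measure P A * measure P B"
proof -
  interpret P: prob_space P
    unfolding P_def using M by (rule prob_space_PiM_UNIV)
  let ?T = "\<lambda>(\<omega>, \<omega>'). splice S \<omega> \<omega>'"
  have T [measurable]: "?T \<in> P \<Otimes>\<^sub>M P \<rightarrow>\<^sub>M P"
    unfolding P_def by (rule measurable_splice)
  have AB: "A \<subseteq> space P" "B \<subseteq> space P"
    using A B by (auto dest: sets.sets_into_space)
  have "splice S \<omega> \<omega>' \<in> A \<longleftrightarrow> \<omega> \<in> A" "splice S \<omega> \<omega>' \<in> B \<longleftrightarrow> \<omega>' \<in> B" for \<omega> \<omega>'
    using A(2) B(2) unfolding determined_by_def by (metis splice_def, metis ComplD splice_def)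
  then have "?T -` (A \<inter> B) \<inter> space (P \<Otimes>\<^sub>M P) = A \<times> B"
    using AB by (auto simp: space_pair_measure)
  moreover have "emeasure P (A \<inter> B) = emeasure (distr (P \<Otimes>\<^sub>M P) P ?T) (A \<inter> B)"
    using distr_splice[OF M, of S] by (simp add: P_def)
  ultimately have "emeasure P (A \<inter> B) = emeasure P A * emeasure P B"
    using A B by (simp add: emeasure_distr P.emeasure_pair_measure_Times)
  then show ?thesis
    by (simp add: measure_def enn2real_mult)
qed

section \<open>Mass transport with percolation\<close>

type_synonym coins = "nat \<times> nat \<Rightarrow> bool"
type_synonym field = "graph \<Rightarrow> coins \<Rightarrow> nat \<Rightarrow> real"

definition coin :: "coins \<Rightarrow> nat \<Rightarrow> nat \<Rightarrow> bool" where
  "coin \<eta> x y = \<eta> (min x y, max x y)"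

text \<open>With every coin heads, the operators on open edges become those of the unkilled walk, so
  one set of lemmas serves both.\<close>

abbreviation all_open :: coins where
  "all_open \<equiv> (\<lambda>_. True)"

lemma coin_commute: "coin \<eta> x y = coin \<eta> y x"
  by (simp add: coin_def min.commute max.commute)

lemma coin_all_open [simp]: "coin all_open x y"
  by (simp add: coin_def)

definition relabel_pair :: "(nat \<Rightarrow> nat) \<Rightarrow> nat \<times> nat \<Rightarrow> nat \<times> nat" where
  "relabel_pair \<pi> = (\<lambda>(a, b). if (a \<le> b) = (inv \<pi> a \<le> inv \<pi> b) then (inv \<pi> a, inv \<pi> b) else (inv \<pi> b, inv \<pi> a))"

text \<open>The coin of an edge is stored at its ordered pair of endpoints, so a relabelling of the vertices
  acts on the coins through the permutation \<^term>\<open>relabel_pair \<pi>\<close> of all ordered pairs, which keeps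
  increasing pairs increasing.\<close>
definition relabel_coins :: "(nat \<Rightarrow> nat) \<Rightarrow> coins \<Rightarrow> coins" where
  "relabel_coins \<pi> \<eta> = (\<lambda>e. \<eta> (relabel_pair \<pi> e))"

lemma relabel_coins_all_open [simp]: "relabel_coins \<pi> all_open = all_open"
  by (simp add: relabel_coins_def)

lemma relabel_apply [simp]: "bij \<pi> \<Longrightarrow> relabel \<pi> G (\<pi> x, \<pi> y) = G (x, y)"
  by (simp add: relabel_def bij_is_inj)

lemma coin_relabel [simp]:
  assumes "bij \<pi>" shows "coin (relabel_coins \<pi> \<eta>) (\<pi> x) (\<pi> y) = coin \<eta> x y"
  using assms by (cases "\<pi> x \<le> \<pi> y"; cases "x \<le> y")
    (auto simp: coin_def relabel_coins_def relabel_pair_def min_def max_def bij_is_inj)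

text \<open>A pair and its image are in the same weak order, so the image determines both the two
  points and their order. Injectivity is what makes relabelled coins have the law of the old
  ones.\<close>

lemma inj_relabel_pair:
  assumes "bij \<pi>" shows "inj (relabel_pair \<pi>)"
proof -
  have "inv \<pi> a = inv \<pi> b \<longleftrightarrow> a = b" for a b
    using assms by (metis bij_inv_eq_iff)
  then show ?thesis
    by (auto simp: inj_def relabel_pair_def split: if_splits)
qed

lemma sets_perc_space: "sets (perc_space q) = sets graph_space"
  unfolding perc_space_def graph_space_def by (intro sets_PiM_cong) auto

lemma space_graph_space [simp]: "space graph_space = UNIV"
  by (simp add: graph_space_def space_PiM)

lemma space_perc_space [simp]: "space (perc_space q) = UNIV"
  by (simp add: perc_space_def space_PiM)

lemma prob_space_perc_space: "prob_space (perc_space q)"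
  unfolding perc_space_def by (intro prob_space_PiM_UNIV prob_space_measure_pmf)

lemma measurable_graph_space_component [measurable]:
  "(\<lambda>G. G e) \<in> graph_space \<rightarrow>\<^sub>M count_space UNIV"
  unfolding graph_space_def by simp

lemma distr_relabel_coins:
  assumes "bij \<pi>"
  shows "distr (perc_space q) (perc_space q) (relabel_coins \<pi>) = perc_space q"
  unfolding perc_space_def relabel_coins_def[abs_def]
  by (intro distr_PiM_UNIV_reindex prob_space_measure_pmf inj_relabel_pair assms)

lemma measurable_relabel_coins [measurable]: "relabel_coins \<pi> \<in> graph_space \<rightarrow>\<^sub>M graph_space"
  unfolding relabel_coins_def[abs_def] graph_space_def
  by (intro measurable_PiM_single') (auto simp: space_PiM)

lemma measurable_perc_space [simp]:
  "measurable (perc_space q) N = measurable graph_space N"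
  "measurable N (perc_space q) = measurable N graph_space"
  by (intro measurable_cong_sets refl sets_perc_space)+

lemma measurable_pair_perc_space:
  "measurable (M \<Otimes>\<^sub>M perc_space q) N = measurable (M \<Otimes>\<^sub>M graph_space) N"
  by (intro measurable_cong_sets sets_pair_measure_cong refl sets_perc_space)

lemma nn_integral_relabel_coins:
  assumes "bij \<pi>" and f: "f \<in> borel_measurable graph_space"
  shows "(\<integral>\<^sup>+\<eta>. f (relabel_coins \<pi> \<eta>) \<partial>perc_space q) = (\<integral>\<^sup>+\<eta>. f \<eta> \<partial>perc_space q)"
  using nn_integral_distr[of "relabel_coins \<pi>" "perc_space q" "perc_space q" f] assms
  by (simp add: distr_relabel_coins)

lemma suminf_bij_ennreal:
  fixes f :: "nat \<Rightarrow> ennreal"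
  assumes "bij \<pi>" shows "(\<Sum>y. f (\<pi> y)) = (\<Sum>y. f y)"
  using nn_integral_bij_count_space[OF assms, of f] by (simp add: nn_integral_count_space_nat)

definition invariant_field :: "(graph \<Rightarrow> coins \<Rightarrow> nat \<Rightarrow> 'b) \<Rightarrow> bool" where
  "invariant_field s \<longleftrightarrow>
    (\<forall>\<pi> G \<eta> x. bij \<pi> \<longrightarrow> s (relabel \<pi> G) (relabel_coins \<pi> \<eta>) (\<pi> x) = s G \<eta> x)"

text \<open>Averaging over the coins leaves a function of the graph and two vertices. It is
  invariant because permuting the coins preserves their law, so the mass transport principle for the
  graph alone applies to it.\<close>

lemma mass_transport_percolation:
  fixes F :: "graph \<Rightarrow> coins \<Rightarrow> nat \<Rightarrow> nat \<Rightarrow> ennreal"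
  assumes uni: "unimodular \<mu>" and sets: "sets \<mu> = sets graph_space"
    and meas: "\<And>x y. (\<lambda>(G, \<eta>). F G \<eta> x y) \<in> borel_measurable (graph_space \<Otimes>\<^sub>M graph_space)"
    and inv: "\<And>\<pi> G \<eta> x y. bij \<pi> \<Longrightarrow>
      F (relabel \<pi> G) (relabel_coins \<pi> \<eta>) (\<pi> x) (\<pi> y) = F G \<eta> x y"
  shows "(\<integral>\<^sup>+G. \<integral>\<^sup>+\<eta>. (\<Sum>y. F G \<eta> 0 y) \<partial>perc_space q \<partial>\<mu>)
    = (\<integral>\<^sup>+G. \<integral>\<^sup>+\<eta>. (\<Sum>y. F G \<eta> y 0) \<partial>perc_space q \<partial>\<mu>)"
proof -
  interpret Q: prob_space "perc_space q" by (rule prob_space_perc_space)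
  define f where "f = (\<lambda>(G, x, y). \<integral>\<^sup>+\<eta>. F G \<eta> x y \<partial>perc_space q)"
  have F_meas: "(\<lambda>\<eta>. F G \<eta> x y) \<in> borel_measurable graph_space" for G x y
    using measurable_compose[OF measurable_Pair1' meas[of x y], of G] by simp
  have f_meas': "(\<lambda>G. \<integral>\<^sup>+\<eta>. F G \<eta> x y \<partial>perc_space q) \<in> borel_measurable graph_space" for x y
    using Q.borel_measurable_nn_integral[of "\<lambda>G \<eta>. F G \<eta> x y" graph_space] meas
    by (simp add: measurable_pair_perc_space)
  have "f \<in> borel_measurable (graph_space \<Otimes>\<^sub>M (count_space UNIV \<Otimes>\<^sub>M count_space UNIV))"
  proof -
    have f_meas'': "(\<lambda>w. f (fst w, fst p, snd p)) \<in>
        borel_measurable (graph_space \<Otimes>\<^sub>M (count_space UNIV \<Otimes>\<^sub>M count_space UNIV))" for p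
      using measurable_compose[OF measurable_fst f_meas'[of "fst p" "snd p"]] by (simp add: f_def split_beta)
    \<comment> \<open>Pairs of vertices form a countable discrete space, so measurability may be
      checked with the pair held fixed.\<close>
    have c: "count_space UNIV \<Otimes>\<^sub>M count_space UNIV = (count_space UNIV :: (nat \<times> nat) measure)"
      by (simp add: pair_measure_countable)
    have "(\<lambda>w. f (fst w, fst (snd w), snd (snd w))) \<in>
        borel_measurable (graph_space \<Otimes>\<^sub>M (count_space UNIV \<Otimes>\<^sub>M count_space UNIV))"
      by (rule measurable_compose_countable[where f="\<lambda>p w. f (fst w, fst p, snd p)" and g=snd])
        (use f_meas'' in \<open>auto simp: c[symmetric]\<close>)
    then show ?thesis by simp
  qed
  moreover have "iso_invariant f"
    unfolding iso_invariant_def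
  proof (intro allI impI)
    fix \<pi> :: "nat \<Rightarrow> nat" and G a b assume \<pi>: "bij \<pi>"
    have "f (relabel \<pi> G, \<pi> a, \<pi> b) = (\<integral>\<^sup>+\<eta>. F (relabel \<pi> G) (relabel_coins \<pi> \<eta>) (\<pi> a) (\<pi> b) \<partial>perc_space q)"
      unfolding f_def
      using nn_integral_relabel_coins[OF \<pi> F_meas[of "relabel \<pi> G" "\<pi> a" "\<pi> b"]] by simp
    then show "f (relabel \<pi> G, \<pi> a, \<pi> b) = f (G, a, b)"
      by (simp add: inv \<pi> f_def)
  qed
  ultimately have "(\<integral>\<^sup>+ G. (\<Sum>x. f (G, 0, x)) \<partial>\<mu>) = (\<integral>\<^sup>+ G. (\<Sum>x. f (G, x, 0)) \<partial>\<mu>)"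
    using uni unfolding unimodular_def by blast
  then show ?thesis
    using F_meas by (simp add: f_def nn_integral_suminf)
qed

section \<open>Neighbour sums and the walk on the open edges\<close>

definition nbr_sum :: "graph \<Rightarrow> coins \<Rightarrow> (nat \<Rightarrow> real) \<Rightarrow> nat \<Rightarrow> ennreal" where
  "nbr_sum G \<eta> F x = (\<Sum>y. if G (x, y) \<and> coin \<eta> x y then ennreal (F y) else 0)"

definition deg :: "graph \<Rightarrow> nat \<Rightarrow> real" where
  "deg G x = enn2real (nbr_sum G all_open (\<lambda>_. 1) x)"

text \<open>Division by the full degree kills the walk at a closed edge. The sums live in
  \<open>ennreal\<close>, so measurability and invariance hold on every graph; at a vertex of
  infinite degree both \<open>deg\<close> and \<open>avg\<close> are \<open>0\<close>.\<close>

definition avg :: "graph \<Rightarrow> coins \<Rightarrow> (nat \<Rightarrow> real) \<Rightarrow> nat \<Rightarrow> real" where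
  "avg G \<eta> F x = enn2real (nbr_sum G \<eta> F x) / deg G x"

lemma nbr_sum_finite:
  assumes "finite (nbrs G x)" "\<And>y. 0 \<le> F y"
  shows "nbr_sum G \<eta> F x = ennreal (\<Sum>y | G (x, y) \<and> coin \<eta> x y. F y)"
proof -
  have *: "finite {y. G (x, y) \<and> coin \<eta> x y}"
    by (rule finite_subset[OF _ assms(1)]) (auto simp: nbrs_def)
  have "nbr_sum G \<eta> F x = (\<Sum>y | G (x, y) \<and> coin \<eta> x y. if G (x, y) \<and> coin \<eta> x y then ennreal (F y) else 0)"
    unfolding nbr_sum_def using * by (intro suminf_finite) auto
  then show ?thesis
    using assms by (simp add: sum_ennreal)
qed

lemma deg_eq_card: "finite (nbrs G x) \<Longrightarrow> deg G x = card (nbrs G x)"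
  by (simp add: deg_def nbr_sum_finite nbrs_def)

lemma deg_nonneg: "0 \<le> deg G x"
  by (simp add: deg_def)

lemma avg_finite:
  assumes "finite (nbrs G x)" "\<And>y. 0 \<le> F y"
  shows "avg G \<eta> F x = (\<Sum>y | G (x, y) \<and> coin \<eta> x y. F y) / card (nbrs G x)"
  using assms by (simp add: avg_def nbr_sum_finite deg_eq_card sum_nonneg)

lemma avg_nonneg: "0 \<le> avg G \<eta> F x"
  by (simp add: avg_def deg_nonneg)

lemma nbr_sum_le_deg:
  "(\<And>y. F y \<le> 1) \<Longrightarrow> nbr_sum G \<eta> F x \<le> nbr_sum G all_open (\<lambda>_. 1) x"
  unfolding nbr_sum_def by (intro suminf_le) auto

lemma avg_le_1:
  assumes "\<And>y. F y \<le> 1"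
  shows "avg G \<eta> F x \<le> 1"
proof (cases "nbr_sum G all_open (\<lambda>_. 1) x = \<infinity>")
  case True
  then show ?thesis by (simp add: avg_def deg_def)
next
  case False
  then have "enn2real (nbr_sum G \<eta> F x) \<le> deg G x"
    unfolding deg_def using nbr_sum_le_deg[of F G \<eta> x] assms by (intro enn2real_mono) (auto simp: top.not_eq_extremum)
  then show ?thesis
    by (simp add: avg_def divide_le_eq_1 deg_nonneg) (use deg_nonneg[of G x] in linarith)
qed

text \<open>Weighting by the degree cancels the denominator and leaves a sum over open edges with a
  symmetric kernel, the source of reversibility.\<close>

lemma deg_times_avg:
  assumes "finite (nbrs G x)" "\<And>y. 0 \<le> F y"
  shows "ennreal (deg G x * avg G \<eta> F x) = nbr_sum G \<eta> F x"
  using assms by (auto simp: deg_eq_card avg_finite nbr_sum_finite card_eq_0_iff nbrs_def)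

text \<open>These are the functions of the environment to which mass transport is applied:
  equivariance makes the transported mass invariant, and values in the unit interval together with
  bounded degrees make the integrals finite. The iterations below stay in this class.\<close>

definition unit_field :: "field \<Rightarrow> bool" where
  "unit_field s \<longleftrightarrow> invariant_field s \<and>
     (\<forall>x. (\<lambda>(G, \<eta>). s G \<eta> x) \<in> borel_measurable (graph_space \<Otimes>\<^sub>M graph_space)) \<and>
     (\<forall>G \<eta> x. 0 \<le> s G \<eta> x \<and> s G \<eta> x \<le> 1)"

lemma unit_fieldI:
  assumes "\<And>\<pi> G \<eta> x. bij \<pi> \<Longrightarrow> s (relabel \<pi> G) (relabel_coins \<pi> \<eta>) (\<pi> x) = s G \<eta> x"
    and "\<And>x. (\<lambda>(G, \<eta>). s G \<eta> x) \<in> borel_measurable (graph_space \<Otimes>\<^sub>M graph_space)"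
    and "\<And>G \<eta> x. 0 \<le> s G \<eta> x" "\<And>G \<eta> x. s G \<eta> x \<le> 1"
  shows "unit_field s"
  using assms by (simp add: unit_field_def invariant_field_def)

lemma unit_fieldD:
  assumes "unit_field s"
  shows "bij \<pi> \<Longrightarrow> s (relabel \<pi> G) (relabel_coins \<pi> \<eta>) (\<pi> x) = s G \<eta> x"
    and "(\<lambda>w. s (fst w) (snd w) x) \<in> borel_measurable (graph_space \<Otimes>\<^sub>M graph_space)"
    and "0 \<le> s G \<eta> x" "s G \<eta> x \<le> 1"
  using assms by (simp_all add: unit_field_def invariant_field_def case_prod_unfold)

lemma measurable_coin [measurable]: "(\<lambda>\<eta>. coin \<eta> x y) \<in> graph_space \<rightarrow>\<^sub>M count_space UNIV"
  unfolding coin_def by measurable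

lemma measurable_nbr_sum:
  assumes [measurable]: "\<And>y. (\<lambda>w. s w y) \<in> borel_measurable M" 
    "K \<in> M \<rightarrow>\<^sub>M graph_space" "H \<in> M \<rightarrow>\<^sub>M graph_space"
  shows "(\<lambda>w. nbr_sum (H w) (K w) (s w) x) \<in> borel_measurable M"
  unfolding nbr_sum_def by measurable

lemma measurable_deg [measurable]: "(\<lambda>G. deg G x) \<in> borel_measurable graph_space"
  unfolding deg_def nbr_sum_def by measurable

lemma measurable_avg:
  assumes [measurable]: "\<And>y. (\<lambda>w. s w y) \<in> borel_measurable M" 
    "K \<in> M \<rightarrow>\<^sub>M graph_space" "H \<in> M \<rightarrow>\<^sub>M graph_space"
  shows "(\<lambda>w. avg (H w) (K w) (s w) x) \<in> borel_measurable M"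
  unfolding avg_def using measurable_nbr_sum[OF assms] by measurable

lemma nbr_sum_relabel:
  assumes "bij \<pi>" "\<And>y. F' (\<pi> y) = F y"
  shows "nbr_sum (relabel \<pi> G) (relabel_coins \<pi> \<eta>) F' (\<pi> x) = nbr_sum G \<eta> F x"
  unfolding nbr_sum_def
  by (subst suminf_bij_ennreal[OF assms(1), symmetric]) (simp add: assms cong: if_cong)

lemma deg_relabel: "bij \<pi> \<Longrightarrow> deg (relabel \<pi> G) (\<pi> x) = deg G x"
  unfolding deg_def using nbr_sum_relabel[of \<pi> "\<lambda>_. 1" "\<lambda>_. 1" G all_open x] by simp

lemma avg_relabel:
  assumes "bij \<pi>" "\<And>y. F' (\<pi> y) = F y"
  shows "avg (relabel \<pi> G) (relabel_coins \<pi> \<eta>) F' (\<pi> x) = avg G \<eta> F x"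
  unfolding avg_def using nbr_sum_relabel[where F'=F' and F=F, OF assms] deg_relabel assms(1) by simp

lemma unit_field_avg:
  assumes s: "unit_field s"
  shows "unit_field (\<lambda>G \<eta>. avg G \<eta> (s G \<eta>))" "unit_field (\<lambda>G \<eta>. avg G all_open (s G \<eta>))"
proof -
  note [measurable] = unit_fieldD(2)[OF s]
  have T: "(\<lambda>_. all_open) \<in> M \<rightarrow>\<^sub>M graph_space" for M :: "(graph \<times> coins) measure"
    by simp
  show "unit_field (\<lambda>G \<eta>. avg G \<eta> (s G \<eta>))"
    by (rule unit_fieldI)
      (auto simp: case_prod_unfold avg_nonneg unit_fieldD[OF s] intro!: avg_relabel avg_le_1 measurable_avg)
  show "unit_field (\<lambda>G \<eta>. avg G all_open (s G \<eta>))"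
    using avg_relabel[where \<eta>=all_open] 
    by (intro unit_fieldI)
      (auto simp: case_prod_unfold avg_nonneg unit_fieldD[OF s] intro!: avg_le_1 measurable_avg T)
qed

section \<open>Survival iterations\<close>

text \<open>If each child succeeds independently with probability \<open>t\<close>, and there is one
  child with probability \<open>1 - r\<close> and two with probability \<open>r\<close>, then some
  child succeeds with probability \<open>(1 - r) * t + r * (1 - (1 - t)\<^sup>2)\<close>, which is
  this formula.\<close>

definition survival_map :: "real \<Rightarrow> real \<Rightarrow> real" where
  "survival_map r t = t + r * t * (1 - t)"

text \<open>The antiderivative of \<open>survival_map r\<close> that vanishes at \<open>0\<close>.
  For \<open>r\<close> in the unit interval it is convex there, since \<open>survival_map r\<close>
  is nondecreasing.\<close>

definition survival_primitive :: "real \<Rightarrow> real \<Rightarrow> real" where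
  "survival_primitive r t = t\<^sup>2 / 2 + r * (t\<^sup>2 / 2 - t ^ 3 / 3)"

context
  fixes r :: real
  assumes r: "0 \<le> r" "r \<le> 1"
begin

lemma mult_unit_le:
  assumes "a \<le> c" "0 \<le> c" shows "r * a \<le> c"
proof -
  have "r * a \<le> r * c" "r * c \<le> 1 * c"
    using assms r by (intro mult_left_mono mult_right_mono; simp)+
  then show ?thesis by simp
qed

lemma survival_map_ge: "0 \<le> t \<Longrightarrow> t \<le> 1 \<Longrightarrow> t \<le> survival_map r t"
  using r by (simp add: survival_map_def)

lemma survival_map_nonneg: "0 \<le> t \<Longrightarrow> t \<le> 1 \<Longrightarrow> 0 \<le> survival_map r t"
  using survival_map_ge by fastforce

lemma survival_map_le_1:
  assumes "0 \<le> t" "t \<le> 1" shows "survival_map r t \<le> 1"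
proof -
  have "r * t * (1 - t) \<le> 1 * 1 * (1 - t)"
    using assms r by (intro mult_mono mult_right_mono) (auto intro: mult_le_one)
  then show ?thesis by (simp add: survival_map_def)
qed

lemma survival_map_mono:
  assumes "0 \<le> t" "t \<le> u" "u \<le> 1" shows "survival_map r t \<le> survival_map r u"
proof -
  have "survival_map r u - survival_map r t = (u - t) * (1 + r * (1 - t - u))"
    by (simp add: survival_map_def field_simps)
  moreover have "0 \<le> 1 + r * (1 - t - u)"
    using mult_unit_le[of "t + u - 1" 1] assms by (simp add: algebra_simps)
  ultimately show ?thesis
    using assms by (metis diff_ge_0_iff_ge mult_nonneg_nonneg)
qed

text \<open>Convexity in explicit form: the gap is \<open>(u - t)\<^sup>2\<close> times a factor
  that is nonnegative because \<open>(u + 2 * t) / 3\<close> and \<open>r\<close> are at most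
  \<open>1\<close>.\<close>

lemma survival_primitive_tangent:
  assumes "0 \<le> t" "t \<le> 1" "0 \<le> u" "u \<le> 1"
  shows "survival_map r t * (u - t) \<le> survival_primitive r u - survival_primitive r t"
proof -
  have "survival_primitive r u - survival_primitive r t - survival_map r t * (u - t)
      = (u - t)\<^sup>2 * (1 / 2 + r * (1 / 2 - (u + 2 * t) / 3))"
    by (simp add: survival_map_def survival_primitive_def field_simps power2_eq_square power3_eq_cube)
  moreover have "0 \<le> 1 / 2 + r * (1 / 2 - (u + 2 * t) / 3)"
    using mult_unit_le[of "(u + 2 * t) / 3 - 1 / 2" "1 / 2"] assms by (simp add: field_simps)
  ultimately show ?thesis
    by (metis diff_ge_0_iff_ge zero_le_power2 mult_nonneg_nonneg)
qed

lemma survival_primitive_bounds: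
  assumes "0 \<le> t" "t \<le> 1"
  shows "0 \<le> survival_primitive r t" "survival_primitive r t \<le> t"
proof -
  have t: "t ^ 3 \<le> t\<^sup>2" "0 \<le> t ^ 3" "t\<^sup>2 \<le> t" "0 \<le> t\<^sup>2"
    using assms by (auto simp: power2_eq_square power3_eq_cube mult_le_cancel_left1 mult_le_cancel_right1 mult_left_le)
  then have u: "0 \<le> t\<^sup>2 / 2 - t ^ 3 / 3"
    by linarith
  have "0 \<le> r * (t\<^sup>2 / 2 - t ^ 3 / 3)" "r * (t\<^sup>2 / 2 - t ^ 3 / 3) \<le> t\<^sup>2 / 2 - t ^ 3 / 3"
    using r u by (auto intro!: mult_nonneg_nonneg mult_unit_le)
  with t show "0 \<le> survival_primitive r t" "survival_primitive r t \<le> t"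
    unfolding survival_primitive_def by linarith+
qed

end

lemma survival_map_simps [simp]:
  "survival_map r 1 = 1" "survival_primitive r 1 = 1 / 2 + r / 6"
  by (simp_all add: survival_map_def survival_primitive_def)

lemma measurable_survival_map [measurable]:
  "survival_map r \<in> borel_measurable borel" "survival_primitive r \<in> borel_measurable borel"
  unfolding survival_map_def[abs_def] survival_primitive_def[abs_def] by measurable

section \<open>The iterations on vertices\<close>

context
  fixes r :: real
begin

text \<open>A lower bound for the probability, given the coins, of an open line of \<open>n\<close>
  descendants; see \<open>prob_alive_ge\<close>.\<close>

primrec survival :: "nat \<Rightarrow> field" where
  "survival 0 = (\<lambda>G \<eta> x. 1)"
| "survival (Suc n) = (\<lambda>G \<eta> x. survival_map r (avg G \<eta> (survival n G \<eta>) x))"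

definition mean_survival :: "real \<Rightarrow> nat \<Rightarrow> graph \<Rightarrow> nat \<Rightarrow> real" where
  "mean_survival q n G x = (\<integral>\<eta>. survival n G \<eta> x \<partial>perc_space q)"

text \<open>Unlike the law of the branching walk itself, which uses the order of the vertex names, this lower
  bound for the probability that the trace of the walk from a vertex percolates is visibly invariant
  under relabellings.\<close>
primrec goodness :: "real \<Rightarrow> nat \<Rightarrow> graph \<Rightarrow> nat \<Rightarrow> real" where
  "goodness q 0 = (\<lambda>G x. INF n. mean_survival q n G x)"
| "goodness q (Suc n) = (\<lambda>G x. max (goodness q n G x) (survival_map r (avg G all_open (goodness q n G) x)))"

definition limit_goodness :: "real \<Rightarrow> graph \<Rightarrow> nat \<Rightarrow> real" where
  "limit_goodness q G x = (SUP n. goodness q n G x)"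

text \<open>By the zero-one law below, a root is almost surely bad exactly when the lower bound
  fails to reach \<open>1\<close> there. The energy argument, run on bad vertices alone, shows that
  this has probability \<open>0\<close>.\<close>

definition bad_vertex :: "real \<Rightarrow> graph \<Rightarrow> nat \<Rightarrow> real" where
  "bad_vertex q G x = (if limit_goodness q G x = 0 then 1 else 0)"

text \<open>The iteration \<open>survival\<close> confined to the bad vertices. Its mean tends to
  \<open>0\<close> by the choice of these vertices, which the energy contradicts unless they are
  negligible.\<close>

primrec bad_survival :: "real \<Rightarrow> nat \<Rightarrow> field" where
  "bad_survival q 0 = (\<lambda>G \<eta> x. bad_vertex q G x)"
| "bad_survival q (Suc n) = (\<lambda>G \<eta> x. bad_vertex q G x * survival_map r (avg G \<eta> (bad_survival q n G \<eta>) x))"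

text \<open>The starting value \<open>1\<close> is a fixed point of \<^term>\<open>survival_map r\<close>, so that
  \<^term>\<open>bad_survival\<close> arises from \<open>bad_average\<close> in the same way at step \<open>0\<close> as at later steps.\<close>
primrec bad_average :: "real \<Rightarrow> nat \<Rightarrow> field" where
  "bad_average q 0 = (\<lambda>G \<eta> x. 1)"
| "bad_average q (Suc n) = (\<lambda>G \<eta> x. avg G \<eta> (bad_survival q n G \<eta>) x)"

end

section \<open>Closure properties of unit fields\<close>

lemma unit_field_const: "0 \<le> c \<Longrightarrow> c \<le> 1 \<Longrightarrow> unit_field (\<lambda>G \<eta> x. c)"
  by (rule unit_fieldI) auto

lemma unit_field_mult: "unit_field s \<Longrightarrow> unit_field t \<Longrightarrow> unit_field (\<lambda>G \<eta> x. s G \<eta> x * t G \<eta> x)"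
  by (rule unit_fieldI) (auto simp: unit_fieldD case_prod_unfold intro!: mult_le_one borel_measurable_times)

lemma unit_field_max: "unit_field s \<Longrightarrow> unit_field t \<Longrightarrow> unit_field (\<lambda>G \<eta> x. max (s G \<eta> x) (t G \<eta> x))"
  by (rule unit_fieldI) (auto simp: unit_fieldD case_prod_unfold le_max_iff_disj intro!: borel_measurable_max)

lemma unit_field_survival_map:
  "0 \<le> r \<Longrightarrow> r \<le> 1 \<Longrightarrow> unit_field s \<Longrightarrow> unit_field (\<lambda>G \<eta> x. survival_map r (s G \<eta> x))"
  by (rule unit_fieldI)
    (auto simp: unit_fieldD case_prod_unfold survival_map_nonneg survival_map_le_1
      intro!: measurable_compose[OF unit_fieldD(2) measurable_survival_map(1)])

text \<open>Invariance survives because relabelling preserves the law of the coins. The mean no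
  longer depends on the coins but is kept as a field, so that the operations on fields apply to
  it.\<close>

lemma unit_field_cmean:
  assumes s: "unit_field s"
  shows "unit_field (\<lambda>G \<eta> x. \<integral>\<eta>. s G \<eta> x \<partial>perc_space q)"
proof (rule unit_fieldI)
  interpret Q: prob_space "perc_space q" by (rule prob_space_perc_space)
  have meas: "(\<lambda>\<eta>. s G \<eta> x) \<in> borel_measurable graph_space" for G x
    using measurable_compose[OF measurable_Pair1' unit_fieldD(2)[OF s, of x], of G] by simp
  have int: "integrable (perc_space q) (\<lambda>\<eta>. s G \<eta> x)" for G x
    using unit_fieldD(3,4)[OF s] meas
    by (intro Q.integrable_const_bound[where B=1]) auto
  show "0 \<le> (\<integral>\<eta>. s G \<eta> x \<partial>perc_space q)" "(\<integral>\<eta>. s G \<eta> x \<partial>perc_space q) \<le> 1" for G x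
    using unit_fieldD(3,4)[OF s] int by (auto intro!: Q.integral_le_const)
  show "(\<integral>\<eta>. s (relabel \<pi> G) \<eta> (\<pi> x) \<partial>perc_space q) = (\<integral>\<eta>. s G \<eta> x \<partial>perc_space q)" if \<pi>: "bij \<pi>" for \<pi> G x
  proof -
    have "(\<integral>\<eta>. s (relabel \<pi> G) \<eta> (\<pi> x) \<partial>perc_space q)
        = (\<integral>\<eta>. s (relabel \<pi> G) \<eta> (\<pi> x) \<partial>distr (perc_space q) (perc_space q) (relabel_coins \<pi>))"
      using \<pi> by (simp add: distr_relabel_coins)
    also have "\<dots> = (\<integral>\<eta>. s (relabel \<pi> G) (relabel_coins \<pi> \<eta>) (\<pi> x) \<partial>perc_space q)"
      using meas by (intro integral_distr) auto
    finally show ?thesis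
      by (simp add: unit_fieldD(1)[OF s \<pi>])
  qed
  show "(\<lambda>(G, \<eta>). \<integral>\<eta>. s G \<eta> x \<partial>perc_space q) \<in> borel_measurable (graph_space \<Otimes>\<^sub>M graph_space)" for x
  proof -
    have "(\<lambda>G. \<integral>\<eta>. s G \<eta> x \<partial>perc_space q) \<in> borel_measurable graph_space"
      using unit_fieldD(2)[OF s, of x]
      by (intro Q.borel_measurable_lebesgue_integral) (simp add: case_prod_unfold measurable_pair_perc_space)
    then show ?thesis
      unfolding case_prod_unfold by (rule measurable_compose[OF measurable_fst])
  qed
qed

lemma unit_field_bdd:
  assumes "\<And>n. unit_field (s n)"
  shows "bdd_below (range (\<lambda>n. s n G \<eta> x))" "bdd_above (range (\<lambda>n. s n G \<eta> x))"
  using unit_fieldD(3,4)[OF assms] by (auto intro!: bdd_belowI bdd_aboveI)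

lemma unit_field_INF:
  fixes s :: "nat \<Rightarrow> field"
  assumes s: "\<And>n. unit_field (s n)"
  shows "unit_field (\<lambda>G \<eta> x. INF n. s n G \<eta> x)"
proof (rule unit_fieldI)
  show "(\<lambda>(G, \<eta>). INF n. s n G \<eta> x) \<in> borel_measurable (graph_space \<Otimes>\<^sub>M graph_space)" for x
    unfolding case_prod_unfold
    by (rule borel_measurable_cINF) (auto simp: unit_fieldD(2)[OF s] unit_field_bdd[OF s])
  show "0 \<le> (INF n. s n G \<eta> x)" for G \<eta> x
    using unit_fieldD(3)[OF s] by (intro cINF_greatest) auto
  show "(INF n. s n G \<eta> x) \<le> 1" for G \<eta> x
    using unit_fieldD(4)[OF s] unit_field_bdd[OF s] by (intro cINF_lower2[where x=0]) auto
qed (simp add: unit_fieldD(1)[OF s])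

lemma unit_field_SUP:
  fixes s :: "nat \<Rightarrow> field"
  assumes s: "\<And>n. unit_field (s n)"
  shows "unit_field (\<lambda>G \<eta> x. SUP n. s n G \<eta> x)"
proof (rule unit_fieldI)
  show "(\<lambda>(G, \<eta>). SUP n. s n G \<eta> x) \<in> borel_measurable (graph_space \<Otimes>\<^sub>M graph_space)" for x
    unfolding case_prod_unfold
    by (rule borel_measurable_cSUP) (auto simp: unit_fieldD(2)[OF s] unit_field_bdd[OF s])
  show "(SUP n. s n G \<eta> x) \<le> 1" for G \<eta> x
    using unit_fieldD(4)[OF s] by (intro cSUP_least) auto
  show "0 \<le> (SUP n. s n G \<eta> x)" for G \<eta> x
    using unit_fieldD(3)[OF s] unit_field_bdd[OF s] by (intro cSUP_upper2[where x=0]) auto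
qed (simp add: unit_fieldD(1)[OF s])

context
  fixes r :: real
  assumes r: "0 \<le> r" "r \<le> 1"
begin

lemma unit_field_survival: "unit_field (survival r n)"
  by (induction n) (auto intro!: unit_field_const unit_field_survival_map r unit_field_avg)

lemma unit_field_mean_survival: "unit_field (\<lambda>G \<eta>. mean_survival r q n G)"
  unfolding mean_survival_def[abs_def] by (intro unit_field_cmean unit_field_survival)

lemma unit_field_goodness: "unit_field (\<lambda>G \<eta>. goodness r q n G)"
proof (induction n)
  case 0
  then show ?case
    using unit_field_INF[of "\<lambda>n G \<eta>. mean_survival r q n G"] unit_field_mean_survival by simp
next
  case (Suc n)
  then show ?case
    using unit_field_avg(2)[OF Suc] by (auto intro!: unit_field_max unit_field_survival_map r)
qed

lemma unit_field_limit_goodness: "unit_field (\<lambda>G \<eta>. limit_goodness r q G)"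
  unfolding limit_goodness_def[abs_def]
  using unit_field_SUP[of "\<lambda>n G \<eta>. goodness r q n G"] unit_field_goodness by simp

lemma unit_field_bad_vertex: "unit_field (\<lambda>G \<eta>. bad_vertex r q G)"
proof (rule unit_fieldI)
  show "(\<lambda>(G, \<eta>). bad_vertex r q G x) \<in> borel_measurable (graph_space \<Otimes>\<^sub>M graph_space)" for x
    using unit_fieldD(2)[OF unit_field_limit_goodness[of q], of x]
    unfolding case_prod_unfold bad_vertex_def by measurable
qed (auto simp: bad_vertex_def unit_fieldD(1)[OF unit_field_limit_goodness])

lemma unit_field_bad_survival: "unit_field (bad_survival r q n)"
  by (induction n)
    (auto intro!: unit_field_bad_vertex unit_field_survival_map r unit_field_avg unit_field_mult)

lemma unit_field_bad_average: "unit_field (bad_average r q n)"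
  by (cases n) (auto intro!: unit_field_const unit_field_avg unit_field_bad_survival)

end

section \<open>The energy argument\<close>

declare survival.simps(2) [simp del] bad_survival.simps(2) [simp del] bad_average.simps(2) [simp del]

lemma bounded_degree_graphD:
  assumes "bounded_degree_graph D G"
  shows "G (x, y) \<longleftrightarrow> G (y, x)" "finite (nbrs G x)" "card (nbrs G x) \<le> D" "nbrs G x \<noteq> {}"
    "(x, y) \<in> (edge_rel G)\<^sup>*"
proof -
  show "nbrs G x \<noteq> {}"
  proof -
    \<comment> \<open>The vertex set is all of \<open>nat\<close>, so there is a vertex other than
      \<open>x\<close>; the first edge of a path to it gives a neighbour.\<close>
    have "(x, Suc x) \<in> (edge_rel G)\<^sup>*"
      using assms by (simp add: bounded_degree_graph_def)
    then show ?thesis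
      by (cases rule: converse_rtranclE) (auto simp: edge_rel_def nbrs_def)
  qed
qed (use assms in \<open>auto simp: bounded_degree_graph_def\<close>)

lemma bounded_degree_deg:
  assumes "bounded_degree_graph D G"
  shows "1 \<le> deg G x" "deg G x \<le> D"
  using bounded_degree_graphD(2-4)[OF assms, of x]
  by (auto simp: deg_eq_card Suc_le_eq card_gt_0_iff)

lemma avg_all_open_const:
  assumes "bounded_degree_graph D G" "0 \<le> c"
  shows "avg G all_open (\<lambda>_. c) x = c"
  using bounded_degree_graphD(2,4)[OF assms(1), of x] assms(2)
  by (simp add: avg_finite nbrs_def)

lemma avg_all_open_eq_0_iff:
  assumes G: "bounded_degree_graph D G" and F: "\<And>y. 0 \<le> F y"
  shows "avg G all_open F x = 0 \<longleftrightarrow> (\<forall>y. G (x, y) \<longrightarrow> F y = 0)"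
  using bounded_degree_graphD(2,4)[OF G, of x] F
  by (auto simp: avg_finite nbrs_def sum_nonneg_eq_0_iff)

lemma avg_mono:
  assumes "finite (nbrs G x)" "\<And>y. 0 \<le> F y" "\<And>y. F y \<le> F' y"
  shows "avg G \<eta> F x \<le> avg G \<eta> F' x"
  using assms order_trans[OF assms(2,3)]
  by (auto simp: avg_finite intro!: divide_right_mono sum_mono)

lemma tendsto_avg:
  assumes "finite (nbrs G x)" "\<And>n y. 0 \<le> F n y" "\<And>y. (\<lambda>n. F n y) \<longlonglongrightarrow> F' y" "\<And>y. 0 \<le> F' y"
  shows "(\<lambda>n. avg G \<eta> (F n) x) \<longlonglongrightarrow> avg G \<eta> F' x"
proof -
  have "(\<lambda>n. (\<Sum>y | G (x, y) \<and> coin \<eta> x y. F n y) / card (nbrs G x))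
      \<longlonglongrightarrow> (\<Sum>y | G (x, y) \<and> coin \<eta> x y. F' y) / card (nbrs G x)"
    unfolding divide_inverse by (intro tendsto_intros assms)
  then show ?thesis
    using assms by (simp add: avg_finite)
qed

lemma prob_coin:
  assumes "0 \<le> q" "q \<le> 1"
  shows "(\<integral>\<eta>. of_bool (coin \<eta> x y) \<partial>perc_space q) = q"
proof -
  let ?e = "(min x y, max x y)"
  have d: "distr (perc_space q) (measure_pmf (bernoulli_pmf q)) (\<lambda>\<eta>. \<eta> ?e) = measure_pmf (bernoulli_pmf q)"
    unfolding perc_space_def by (intro distr_PiM_component prob_space_measure_pmf) auto
  have "(\<integral>\<eta>. (of_bool (coin \<eta> x y) :: real) \<partial>perc_space q)
      = (\<integral>b. of_bool b \<partial>distr (perc_space q) (measure_pmf (bernoulli_pmf q)) (\<lambda>\<eta>. \<eta> ?e))"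
    unfolding coin_def by (rule integral_distr[where f="of_bool :: bool \<Rightarrow> real" and g="\<lambda>\<eta>. \<eta> ?e", symmetric]) auto
  also have "\<dots> = q"
    unfolding d using assms by simp
  finally show ?thesis .
qed

text \<open>The iteration starts at the largest value \<open>1\<close> and applies a monotone map,
  so it decreases for each configuration of coins.\<close>

lemma decseq_mean_survival:
  assumes r: "0 \<le> r" "r \<le> 1" and G: "\<And>x. finite (nbrs G x)"
  shows "decseq (\<lambda>n. mean_survival r q n G x)"
proof (rule decseq_SucI)
  interpret Q: prob_space "perc_space q" by (rule prob_space_perc_space)
  note S = unit_field_survival[OF r]
  have "survival r (Suc n) G \<eta> x \<le> survival r n G \<eta> x" for n \<eta> x
  proof (induction n arbitrary: x)
    case 0
    then show ?case
      unfolding survival.simps by (intro survival_map_le_1 r avg_nonneg avg_le_1 order_refl)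
  next
    case (Suc n)
    have "survival_map r (avg G \<eta> (survival r (Suc n) G \<eta>) x) \<le> survival_map r (avg G \<eta> (survival r n G \<eta>) x)"
      by (intro survival_map_mono r avg_nonneg avg_mono G avg_le_1 unit_fieldD[OF S] Suc)
    then show ?case by (simp add: survival.simps(2))
  qed
  moreover have meas: "(\<lambda>\<eta>. survival r n G \<eta> x) \<in> borel_measurable graph_space" for n
    using measurable_compose[OF measurable_Pair1' unit_fieldD(2)[OF S[of n], of x], of G] by simp
  moreover have "integrable (perc_space q) (\<lambda>\<eta>. survival r n G \<eta> x)" for n
    using unit_fieldD(3,4)[OF S] meas by (intro Q.integrable_const_bound[where B=1]) auto
  ultimately show "mean_survival r q (Suc n) G x \<le> mean_survival r q n G x" for n
    unfolding mean_survival_def by (intro integral_mono) auto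
qed

lemma goodness_limit:
  assumes r: "0 \<le> r" "r \<le> 1"
  shows "(\<lambda>n. goodness r q n G x) \<longlonglongrightarrow> limit_goodness r q G x"
  unfolding limit_goodness_def
  using unit_field_bdd(2)[of "\<lambda>n G \<eta>. goodness r q n G"] unit_field_goodness[OF r]
  by (intro LIMSEQ_incseq_SUP incseq_SucI) auto

lemma goodness_le_limit:
  assumes r: "0 \<le> r" "r \<le> 1"
  shows "goodness r q n G x \<le> limit_goodness r q G x"
  unfolding limit_goodness_def
  using unit_field_bdd(2)[of "\<lambda>n G \<eta>. goodness r q n G"] unit_field_goodness[OF r]
  by (intro cSUP_upper) auto

text \<open>The recursion for \<open>goodness\<close> gives this inequality with step
  \<open>n\<close> on the left; averages over finitely many neighbours pass to the limit.\<close>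

lemma limit_goodness_ge:
  assumes r: "0 \<le> r" "r \<le> 1" and G: "finite (nbrs G x)"
  shows "survival_map r (avg G all_open (limit_goodness r q G) x) \<le> limit_goodness r q G x"
proof (rule LIMSEQ_le_const2)
  note g = unit_field_goodness[OF r] and l = unit_field_limit_goodness[OF r]
  show "(\<lambda>n. survival_map r (avg G all_open (goodness r q n G) x))
      \<longlonglongrightarrow> survival_map r (avg G all_open (limit_goodness r q G) x)"
    unfolding survival_map_def using unit_fieldD(3)[OF g] unit_fieldD(3)[OF l]
    by (intro tendsto_intros tendsto_avg G goodness_limit r) auto
  have "survival_map r (avg G all_open (goodness r q n G) x) \<le> limit_goodness r q G x" for n
    using goodness_le_limit[OF r, of q "Suc n" G x] by simp
  then show "\<exists>N. \<forall>n\<ge>N. survival_map r (avg G all_open (goodness r q n G) x) \<le> limit_goodness r q G x"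
    by blast
qed

section \<open>Mass transport and reversibility on a unimodular random graph with coins\<close>

locale unimodular_random_graph = prob_space \<mu> for \<mu> :: "graph measure" +
  fixes D :: nat and q r :: real
  assumes sets_mu: "sets \<mu> = sets graph_space"
    and bounded_degree: "AE G in \<mu>. bounded_degree_graph D G"
    and unimodular: "unimodular \<mu>"
    and r: "0 \<le> r" "r \<le> 1" and q: "0 \<le> q" "q \<le> 1"
begin

sublocale Q: prob_space "perc_space q"
  by (rule prob_space_perc_space)

sublocale P: pair_sigma_finite \<mu> "perc_space q" ..

abbreviation "E \<equiv> \<mu> \<Otimes>\<^sub>M perc_space q"

sublocale E: prob_space E
  by (rule prob_space_pair) (rule prob_space_axioms Q.prob_space_axioms)+

lemma sets_E: "sets E = sets (graph_space \<Otimes>\<^sub>M graph_space)"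
  by (intro sets_pair_measure_cong sets_mu sets_perc_space)

lemma measurable_E: "measurable E N = measurable (graph_space \<Otimes>\<^sub>M graph_space) N"
  by (intro measurable_cong_sets sets_E refl)

lemma measurable_mu: "measurable \<mu> N = measurable graph_space N"
  by (intro measurable_cong_sets sets_mu refl)

lemma AE_E_fst: 
  assumes "AE G in \<mu>. P G" shows "AE w in E. P (fst w)"
proof -
  have "distr E \<mu> fst = \<mu>"
    by (rule Q.distr_pair_fst)
  then show ?thesis
    using AE_distrD[of fst E \<mu> P] assms measurable_fst by (metis (lifting))
qed

lemma AE_mu_fst:
  assumes "AE w in E. P (fst w)" shows "AE G in \<mu>. P G"
proof -
  have "AE G in \<mu>. AE \<eta> in perc_space q. P G"
    using P.AE_pair[OF assms] by simp
  then show ?thesis by simp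
qed

lemma unit_field_measurable:
  "unit_field s \<Longrightarrow> (\<lambda>w. s (fst w) (snd w) x) \<in> borel_measurable E"
  unfolding measurable_E by (rule unit_fieldD(2))

lemma measurable_deg_E [measurable]: "(\<lambda>w. deg (fst w) x) \<in> borel_measurable E"
  unfolding measurable_E by (rule measurable_compose[OF measurable_fst measurable_deg])

lemma bounded_degree_E: "AE w in E. bounded_degree_graph D (fst w)"
  using bounded_degree by (rule AE_E_fst)

lemma integrable_deg_mult:
  assumes [measurable]: "f \<in> borel_measurable E" and "\<And>w. \<bar>f w\<bar> \<le> C"
  shows "integrable E (\<lambda>w. deg (fst w) 0 * f w)"
proof (rule E.integrable_const_bound[where B="D * C"])
  show "AE w in E. norm (deg (fst w) 0 * f w) \<le> D * C"
    using bounded_degree_E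
  proof eventually_elim
    case (elim w)
    then show ?case
      using assms(2)[of w] bounded_degree_deg[OF elim, of 0] by (auto simp: abs_mult intro!: mult_mono)
  qed
qed simp

text \<open>A vertex \<open>x\<close> sends mass \<open>s x * t y\<close> to each neighbour
  \<open>y\<close> across an edge open in \<open>K \<eta>\<close>, and the expected mass sent by the
  root equals that received. Taking \<open>K\<close> to be the identity or constantly
  \<open>all_open\<close> covers the walk on open edges and the full walk at once.\<close>

lemma nn_integral_mass_transport:
  assumes s: "unit_field s" and t: "unit_field t"
    and K: "K \<in> graph_space \<rightarrow>\<^sub>M graph_space" "\<And>\<pi> \<eta>. bij \<pi> \<Longrightarrow> K (relabel_coins \<pi> \<eta>) = relabel_coins \<pi> (K \<eta>)"
  shows "(\<integral>\<^sup>+G. \<integral>\<^sup>+\<eta>. ennreal (s G \<eta> 0) * nbr_sum G (K \<eta>) (t G \<eta>) 0 \<partial>perc_space q \<partial>\<mu>)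
       = (\<integral>\<^sup>+G. \<integral>\<^sup>+\<eta>. ennreal (t G \<eta> 0) * nbr_sum G (K \<eta>) (s G \<eta>) 0 \<partial>perc_space q \<partial>\<mu>)"
proof -
  define F where "F G \<eta> x y = (if G (x, y) \<and> G (y, x) \<and> coin (K \<eta>) x y
      then ennreal (s G \<eta> x) * ennreal (t G \<eta> y) else 0)" for G \<eta> x y
  note [measurable] = unit_fieldD(2)[OF s] unit_fieldD(2)[OF t] K(1)
  have 1: "(\<integral>\<^sup>+G. \<integral>\<^sup>+\<eta>. (\<Sum>y. F G \<eta> 0 y) \<partial>perc_space q \<partial>\<mu>)
      = (\<integral>\<^sup>+G. \<integral>\<^sup>+\<eta>. (\<Sum>y. F G \<eta> y 0) \<partial>perc_space q \<partial>\<mu>)"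
  proof (rule mass_transport_percolation[OF unimodular sets_mu])
    show "(\<lambda>(G, \<eta>). F G \<eta> x y) \<in> borel_measurable (graph_space \<Otimes>\<^sub>M graph_space)" for x y
      unfolding F_def case_prod_unfold by measurable
    show "F (relabel \<pi> G) (relabel_coins \<pi> \<eta>) (\<pi> x) (\<pi> y) = F G \<eta> x y" if "bij \<pi>" for \<pi> G \<eta> x y
      using that by (simp add: F_def K(2) unit_fieldD(1)[OF s] unit_fieldD(1)[OF t])
  qed
  have 2: "(\<Sum>y. F G \<eta> 0 y) = ennreal (s G \<eta> 0) * nbr_sum G (K \<eta>) (t G \<eta>) 0"
    "(\<Sum>y. F G \<eta> y 0) = ennreal (t G \<eta> 0) * nbr_sum G (K \<eta>) (s G \<eta>) 0"
    if G: "bounded_degree_graph D G" for G \<eta>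
  proof -
    have "F G \<eta> 0 y = ennreal (s G \<eta> 0) * (if G (0, y) \<and> coin (K \<eta>) 0 y then ennreal (t G \<eta> y) else 0)"
      "F G \<eta> y 0 = ennreal (t G \<eta> 0) * (if G (0, y) \<and> coin (K \<eta>) 0 y then ennreal (s G \<eta> y) else 0)" for y
      using bounded_degree_graphD(1)[OF G, of 0 y] coin_commute[of "K \<eta>" 0 y]
      by (auto simp: F_def mult.commute)
    then show "(\<Sum>y. F G \<eta> 0 y) = ennreal (s G \<eta> 0) * nbr_sum G (K \<eta>) (t G \<eta>) 0"
      "(\<Sum>y. F G \<eta> y 0) = ennreal (t G \<eta> 0) * nbr_sum G (K \<eta>) (s G \<eta>) 0"
      unfolding nbr_sum_def ennreal_suminf_cmult[symmetric] by simp_all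
  qed
  have "(\<integral>\<^sup>+G. \<integral>\<^sup>+\<eta>. ennreal (s G \<eta> 0) * nbr_sum G (K \<eta>) (t G \<eta>) 0 \<partial>perc_space q \<partial>\<mu>)
      = (\<integral>\<^sup>+G. \<integral>\<^sup>+\<eta>. (\<Sum>y. F G \<eta> 0 y) \<partial>perc_space q \<partial>\<mu>)"
    using bounded_degree by (intro nn_integral_cong_AE) (auto simp: 2)
  also have "\<dots> = (\<integral>\<^sup>+G. \<integral>\<^sup>+\<eta>. ennreal (t G \<eta> 0) * nbr_sum G (K \<eta>) (s G \<eta>) 0 \<partial>perc_space q \<partial>\<mu>)"
    unfolding 1 using bounded_degree by (intro nn_integral_cong_AE) (auto simp: 2)
  finally show ?thesis .
qed

text \<open>Weighted by the degree, the walk on the open edges seen from the root is a self-adjoint operator.\<close>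
lemma self_adjoint:
  assumes s: "unit_field s" and t: "unit_field t"
    and K: "K \<in> graph_space \<rightarrow>\<^sub>M graph_space" "\<And>\<pi> \<eta>. bij \<pi> \<Longrightarrow> K (relabel_coins \<pi> \<eta>) = relabel_coins \<pi> (K \<eta>)"
  shows "(\<integral>w. deg (fst w) 0 * (s (fst w) (snd w) 0 * avg (fst w) (K (snd w)) (t (fst w) (snd w)) 0) \<partial>E)
       = (\<integral>w. deg (fst w) 0 * (t (fst w) (snd w) 0 * avg (fst w) (K (snd w)) (s (fst w) (snd w)) 0) \<partial>E)"
proof -
  have *: "(\<integral>w. deg (fst w) 0 * (s (fst w) (snd w) 0 * avg (fst w) (K (snd w)) (t (fst w) (snd w)) 0) \<partial>E)
       = enn2real (\<integral>\<^sup>+G. \<integral>\<^sup>+\<eta>. ennreal (s G \<eta> 0) * nbr_sum G (K \<eta>) (t G \<eta>) 0 \<partial>perc_space q \<partial>\<mu>)"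
    if s: "unit_field s" and t: "unit_field t" for s t :: field
  proof -
    note [measurable] = unit_field_measurable[OF s]
    have [measurable]: "(\<lambda>w. avg (fst w) (K (snd w)) (t (fst w) (snd w)) 0) \<in> borel_measurable E"
      unfolding measurable_E
      by (intro measurable_avg unit_fieldD(2)[OF t] measurable_compose[OF measurable_snd K(1)] measurable_fst)
    let ?f = "\<lambda>w. deg (fst w) 0 * (s (fst w) (snd w) 0 * avg (fst w) (K (snd w)) (t (fst w) (snd w)) 0)"
    have "(\<integral>w. ?f w \<partial>E) = enn2real (\<integral>\<^sup>+w. ennreal (?f w) \<partial>E)"
      by (intro integral_eq_nn_integral) (auto simp: deg_nonneg avg_nonneg unit_fieldD(3)[OF s])
    also have "(\<integral>\<^sup>+w. ennreal (?f w) \<partial>E) = (\<integral>\<^sup>+G. \<integral>\<^sup>+\<eta>. ennreal (?f (G, \<eta>)) \<partial>perc_space q \<partial>\<mu>)"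
      by (rule Q.nn_integral_fst[symmetric]) simp
    also have "\<dots> = (\<integral>\<^sup>+G. \<integral>\<^sup>+\<eta>. ennreal (s G \<eta> 0) * nbr_sum G (K \<eta>) (t G \<eta>) 0 \<partial>perc_space q \<partial>\<mu>)"
    proof (rule nn_integral_cong_AE, use bounded_degree in eventually_elim)
      case (elim G)
      have "ennreal (?f (G, \<eta>)) = ennreal (s G \<eta> 0) * nbr_sum G (K \<eta>) (t G \<eta>) 0" for \<eta>
        unfolding deg_times_avg[OF bounded_degree_graphD(2)[OF elim] unit_fieldD(3)[OF t], symmetric]
        by (simp add: ennreal_mult'[symmetric] unit_fieldD(3)[OF s] ac_simps)
      then show ?case by simp
    qed
    finally show ?thesis .
  qed
  show ?thesis
    by (subst *[OF s t], subst *[OF t s], rule arg_cong[OF nn_integral_mass_transport[OF s t K]])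
qed

lemma self_adjoint_open:
  assumes s: "unit_field s" and t: "unit_field t"
  shows "(\<integral>w. deg (fst w) 0 * (s (fst w) (snd w) 0 * avg (fst w) (snd w) (t (fst w) (snd w)) 0) \<partial>E)
       = (\<integral>w. deg (fst w) 0 * (t (fst w) (snd w) 0 * avg (fst w) (snd w) (s (fst w) (snd w)) 0) \<partial>E)"
  using self_adjoint[OF s t, of "\<lambda>\<eta>. \<eta>"] by simp

lemma self_adjoint_all_open:
  assumes s: "unit_field s" and t: "unit_field t"
  shows "(\<integral>w. deg (fst w) 0 * (s (fst w) (snd w) 0 * avg (fst w) all_open (t (fst w) (snd w)) 0) \<partial>E)
       = (\<integral>w. deg (fst w) 0 * (t (fst w) (snd w) 0 * avg (fst w) all_open (s (fst w) (snd w)) 0) \<partial>E)"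
  using self_adjoint[OF s t, of "\<lambda>_. all_open"] by simp

text \<open>Let \<open>l\<close> be the limit and \<open>a\<close> its average over neighbours. Then
  \<open>l\<close> is at least \<open>survival_map r a\<close>, hence at least \<open>a\<close>,
  while stationarity gives \<open>l\<close> and \<open>a\<close> the same degree-weighted mean. So
  they agree almost surely, and \<open>r * a * (1 - a)\<close> cannot be positive.\<close>

lemma limit_goodness_zero_one:
  assumes "0 < r"
  shows "AE w in E. (limit_goodness r q (fst w) 0 = 0 \<or> limit_goodness r q (fst w) 0 = 1) \<and>
    avg (fst w) all_open (limit_goodness r q (fst w)) 0 = limit_goodness r q (fst w) 0"
proof -
  let ?l = "\<lambda>w. limit_goodness r q (fst w) 0"
  let ?a = "\<lambda>w. avg (fst w) all_open (limit_goodness r q (fst w)) 0"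
  note l = unit_field_limit_goodness[OF r, of q]
  have la [measurable]: "?l \<in> borel_measurable E" "?a \<in> borel_measurable E"
    using unit_field_measurable[OF l] unit_field_measurable[OF unit_field_avg(2)[OF l]] by auto
  have a01: "0 \<le> ?a w" "?a w \<le> 1" for w
    using unit_fieldD(3,4)[OF unit_field_avg(2)[OF l]] by auto
  have bounds: "\<bar>?l w\<bar> \<le> 1" "\<bar>?a w\<bar> \<le> 1" for w
    using unit_fieldD(3,4)[OF l] a01 by auto
  have int: "integrable E (\<lambda>w. deg (fst w) 0 * ?l w)" "integrable E (\<lambda>w. deg (fst w) 0 * ?a w)"
    by (rule integrable_deg_mult[OF _ bounds(1)], rule la) (rule integrable_deg_mult[OF _ bounds(2)], rule la)
  have ge: "AE w in E. survival_map r (?a w) \<le> ?l w"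
    using bounded_degree_E by eventually_elim (auto intro!: limit_goodness_ge r bounded_degree_graphD(2))
  \<comment> \<open>Stationarity is self-adjointness tested against the constant \<open>1\<close>,
    whose average over neighbours is \<open>1\<close>.\<close>
  have "(\<integral>w. deg (fst w) 0 * ?a w \<partial>E) = (\<integral>w. deg (fst w) 0 * (?l w * avg (fst w) all_open (\<lambda>_. 1) 0) \<partial>E)"
    using self_adjoint_all_open[OF unit_field_const[of 1] l] by simp
  also have "\<dots> = (\<integral>w. deg (fst w) 0 * ?l w \<partial>E)"
  proof (rule integral_cong_AE)
    show "AE w in E. deg (fst w) 0 * (?l w * avg (fst w) all_open (\<lambda>_. 1) 0) = deg (fst w) 0 * ?l w"
      using bounded_degree_E by eventually_elim (simp add: avg_all_open_const)
    have "(\<lambda>w. avg (fst w) all_open (\<lambda>_. 1) 0) \<in> borel_measurable E"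
      using unit_field_measurable[OF unit_field_avg(2)[OF unit_field_const[of 1]]] by simp
    then show "(\<lambda>w. deg (fst w) 0 * (?l w * avg (fst w) all_open (\<lambda>_. 1) 0)) \<in> borel_measurable E"
      by measurable
  qed measurable
  finally have eq: "(\<integral>w. deg (fst w) 0 * ?l w - deg (fst w) 0 * ?a w \<partial>E) = 0"
    using int by simp
  have "AE w in E. 0 \<le> deg (fst w) 0 * ?l w - deg (fst w) 0 * ?a w"
    using ge
  proof eventually_elim
    case (elim w)
    then have "?a w \<le> ?l w"
      using survival_map_ge[OF r a01[of w]] by linarith
    then show ?case
      by (simp add: mult_left_mono deg_nonneg)
  qed
  then have "AE w in E. deg (fst w) 0 * ?l w - deg (fst w) 0 * ?a w = 0"
    using eq int by (subst (asm) integral_nonneg_eq_0_iff_AE) auto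
  then show ?thesis
    using ge bounded_degree_E
  proof eventually_elim
    case (elim w)
    have la: "?l w = ?a w"
      using elim(1) bounded_degree_deg(1)[OF elim(3), of 0] by simp
    then have "\<not> 0 < r * (?a w * (1 - ?a w))"
      using elim(2) by (simp add: survival_map_def mult.assoc)
    then have "\<not> 0 < ?a w * (1 - ?a w)"
      using mult_pos_pos[OF \<open>0 < r\<close>] by blast
    moreover have "0 \<le> ?a w * (1 - ?a w)"
      using a01[of w] by simp
    ultimately have "?a w * (1 - ?a w) = 0"
      by linarith
    then show ?case
      using la by auto
  qed
qed

text \<open>An average of nonnegative numbers vanishes only if all of them do, so badness of the
  root passes to its neighbours. Confinement to bad vertices therefore costs nothing in the first
  step of the iteration.\<close>

lemma bad_vertex_neighbours:
  assumes "0 < r"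
  shows "AE w in E. bad_vertex r q (fst w) 0 = 1 \<longrightarrow> (\<forall>y. (fst w) (0, y) \<longrightarrow> bad_vertex r q (fst w) y = 1)"
  using limit_goodness_zero_one[OF assms] bounded_degree_E
proof eventually_elim
  case (elim w)
  then show ?case
    using avg_all_open_eq_0_iff[OF elim(2), of "limit_goodness r q (fst w)" 0]
      unit_fieldD(3)[OF unit_field_limit_goodness[OF r]]
    by (auto simp: bad_vertex_def split: if_splits)
qed

section \<open>The energy of the iteration on bad vertices\<close>

abbreviation "badv w \<equiv> bad_vertex r q (fst w) 0"
abbreviation "bads n w \<equiv> bad_survival r q n (fst w) (snd w) 0"
abbreviation "bada n w \<equiv> bad_average r q n (fst w) (snd w) 0"

text \<open>Here \<open>bada n\<close> and \<open>bads n\<close> play the roles of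
  \<open>t\<^sub>n\<close> and \<open>s\<^sub>n\<close>. The factor \<open>badv\<close>, which
  \<open>bads n\<close> already contains, restricts every term to bad roots.\<close>

definition energy :: "nat \<Rightarrow> graph \<times> coins \<Rightarrow> real" where
  "energy n w = deg (fst w) 0 *
    (badv w * (survival_primitive r (bada (Suc n) w) + survival_primitive r (bada n w)) - bads n w * bada n w)"

lemma bad_survival_eq: "bad_survival r q n G \<eta> x = bad_vertex r q G x * survival_map r (bad_average r q n G \<eta> x)"
  by (cases n) (auto simp: bad_survival.simps(2) bad_average.simps(2))

lemma bad_bounds:
  "0 \<le> badv w" "badv w \<le> 1" "0 \<le> bads n w" "bads n w \<le> 1" "0 \<le> bada n w" "bada n w \<le> 1"
  using unit_fieldD(3,4)[OF unit_field_bad_vertex[OF r]] unit_fieldD(3,4)[OF unit_field_bad_survival[OF r]]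
    unit_fieldD(3,4)[OF unit_field_bad_average[OF r]] by auto

lemma bad_measurable [measurable]:
  "badv \<in> borel_measurable E" "bads n \<in> borel_measurable E" "bada n \<in> borel_measurable E"
  using unit_field_measurable[OF unit_field_bad_vertex[OF r]] unit_field_measurable[OF unit_field_bad_survival[OF r]]
    unit_field_measurable[OF unit_field_bad_average[OF r]] by auto

lemma primitive_measurable [measurable]:
  "(\<lambda>w. survival_primitive r (bada n w)) \<in> borel_measurable E"
  by (rule measurable_compose[OF bad_measurable(3) measurable_survival_map(2)])

lemma primitive_bounds: "0 \<le> survival_primitive r (bada n w)" "survival_primitive r (bada n w) \<le> 1"
  using survival_primitive_bounds[OF r bad_bounds(5,6), of n w] bad_bounds(6)[of n w] by auto

lemma integrable_energy: "integrable E (energy n)"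
  unfolding energy_def
proof (rule integrable_deg_mult[where C=3])
  fix w
  have *: "\<bar>x - y\<bar> \<le> 3" if "0 \<le> x" "x \<le> 1 * (1 + 1)" "0 \<le> y" "y \<le> 1" for x y :: real
    using that by (auto simp: abs_le_iff)
  have "0 \<le> badv w * (survival_primitive r (bada (Suc n) w) + survival_primitive r (bada n w))"
    "badv w * (survival_primitive r (bada (Suc n) w) + survival_primitive r (bada n w)) \<le> 1 * (1 + 1)"
    using bad_bounds primitive_bounds by (intro mult_nonneg_nonneg add_nonneg_nonneg mult_mono add_mono; simp)+
  moreover have "0 \<le> bads n w * bada n w" "bads n w * bada n w \<le> 1"
    using bad_bounds by (auto intro!: mult_le_one)
  ultimately show "\<bar>badv w * (survival_primitive r (bada (Suc n) w) + survival_primitive r (bada n w)) - bads n w * bada n w\<bar> \<le> 3"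
    by (rule *)
qed measurable

text \<open>The increment of the energy is \<open>?R + ?B - ?A\<close>. Since
  \<open>bada (Suc n)\<close> is the open-edge average of \<open>bads n\<close>, the terms
  \<open>?A\<close> and \<open>?B\<close> pair \<open>bads (Suc n)\<close> and \<open>bads n\<close>
  through that operator in the two orders, and self-adjointness makes their integrals equal;
  \<open>?R\<close> is nonnegative pointwise.\<close>

lemma energy_mono: "(\<integral>w. energy n w \<partial>E) \<le> (\<integral>w. energy (Suc n) w \<partial>E)"
proof -
  let ?\<Phi> = "survival_primitive r"
  let ?A = "\<lambda>w. deg (fst w) 0 * (bads (Suc n) w * bada (Suc n) w)"
  let ?B = "\<lambda>w. deg (fst w) 0 * (bads n w * bada (Suc (Suc n)) w)"
  let ?R = "\<lambda>w. deg (fst w) 0 * (badv w * (?\<Phi> (bada (Suc (Suc n)) w) - ?\<Phi> (bada n w))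
       - bads n w * (bada (Suc (Suc n)) w - bada n w))"
  have mult1: "\<bar>bads m w * bada k w\<bar> \<le> 1" for m k w
    using bad_bounds by (auto intro!: mult_le_one)
  have int: "integrable E ?A" "integrable E ?B"
    by (rule integrable_deg_mult[OF _ mult1], measurable)+
  have AB: "(\<integral>w. ?A w \<partial>E) = (\<integral>w. ?B w \<partial>E)"
    using self_adjoint_open[OF unit_field_bad_survival[OF r, of q "Suc n"] unit_field_bad_survival[OF r, of q n]]
    by (simp add: bad_average.simps(2))
  \<comment> \<open>The tangent to \<open>survival_primitive r\<close> at \<open>bada n w\<close>,
    evaluated two steps later at \<open>bada (Suc (Suc n)) w\<close>; its slope times
    \<open>badv w\<close> is \<open>bads n w\<close>.\<close>
  have "0 \<le> ?R w" for w
  proof -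
    have "0 \<le> badv w * (?\<Phi> (bada (Suc (Suc n)) w) - ?\<Phi> (bada n w)
        - survival_map r (bada n w) * (bada (Suc (Suc n)) w - bada n w))"
      using survival_primitive_tangent[OF r bad_bounds(5,6) bad_bounds(5,6), of n w "Suc (Suc n)" w]
      by (intro mult_nonneg_nonneg bad_bounds) simp
    then have "0 \<le> badv w * (?\<Phi> (bada (Suc (Suc n)) w) - ?\<Phi> (bada n w))
       - bads n w * (bada (Suc (Suc n)) w - bada n w)"
      unfolding bad_survival_eq[of n] by (simp add: algebra_simps)
    then show ?thesis
      by (intro mult_nonneg_nonneg deg_nonneg)
  qed
  moreover have "energy (Suc n) w - energy n w + ?A w - ?B w = ?R w" for w
    unfolding energy_def by (simp add: algebra_simps)
  ultimately have "0 \<le> (\<integral>w. energy (Suc n) w - energy n w + ?A w - ?B w \<partial>E)"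
    by simp
  also have "\<dots> = (\<integral>w. energy (Suc n) w \<partial>E) - (\<integral>w. energy n w \<partial>E) + (\<integral>w. ?A w \<partial>E) - (\<integral>w. ?B w \<partial>E)"
    using int integrable_energy by simp
  finally show ?thesis
    using AB by simp
qed

text \<open>All neighbours of a bad root are bad, so the degree times \<open>bada 1\<close> counts
  the open edges at the root. Given the graph this count has mean \<open>q\<close> times the degree,
  and \<open>badv\<close> does not depend on the coins.\<close>

lemma mean_open_degree:
  assumes "0 < r"
  shows "(\<integral>w. deg (fst w) 0 * (badv w * bada 1 w) \<partial>E) = q * (\<integral>w. deg (fst w) 0 * badv w \<partial>E)"
proof -
  have bnd: "\<bar>badv w * bada 1 w\<bar> \<le> 1" "\<bar>badv w\<bar> \<le> 1" for w
    using bad_bounds by (auto intro!: mult_le_one)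
  have int: "integrable E (\<lambda>w. deg (fst w) 0 * (badv w * bada 1 w))" "integrable E (\<lambda>w. deg (fst w) 0 * badv w)"
    by (rule integrable_deg_mult[OF _ bnd(1)], measurable) (rule integrable_deg_mult[OF _ bnd(2)], measurable)
  have nb: "AE G in \<mu>. bad_vertex r q G 0 = 1 \<longrightarrow> (\<forall>y. G (0, y) \<longrightarrow> bad_vertex r q G y = 1)"
    using bad_vertex_neighbours[OF assms] by (rule AE_mu_fst)
  have "(\<integral>w. deg (fst w) 0 * (badv w * bada 1 w) \<partial>E)
      = (\<integral>G. \<integral>\<eta>. deg G 0 * (bad_vertex r q G 0 * bad_average r q 1 G \<eta> 0) \<partial>perc_space q \<partial>\<mu>)"
    using P.integral_fst'[OF int(1)] by simp
  also have "\<dots> = (\<integral>G. \<integral>\<eta>. q * (deg G 0 * bad_vertex r q G 0) \<partial>perc_space q \<partial>\<mu>)"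
  proof (rule integral_cong_AE)
    show "AE G in \<mu>. (\<integral>\<eta>. deg G 0 * (bad_vertex r q G 0 * bad_average r q 1 G \<eta> 0) \<partial>perc_space q)
        = (\<integral>\<eta>. q * (deg G 0 * bad_vertex r q G 0) \<partial>perc_space q)"
      using nb bounded_degree
    proof eventually_elim
      case (elim G)
      note fin = bounded_degree_graphD(2)[OF elim(2), of 0]
      show ?case
      proof (cases "bad_vertex r q G 0 = 1")
        case True
        have "{y. G (0, y) \<and> coin \<eta> 0 y} \<subseteq> nbrs G 0" for \<eta>
          by (auto simp: nbrs_def)
        then have "(\<Sum>y | G (0, y) \<and> coin \<eta> 0 y. bad_vertex r q G y) = (\<Sum>y\<in>nbrs G 0. of_bool (coin \<eta> 0 y))" for \<eta>
          using fin True elim(1) by (intro sum.mono_neutral_cong_left) (auto simp: nbrs_def)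
        moreover have "avg G \<eta> (bad_vertex r q G) 0
            = (\<Sum>y | G (0, y) \<and> coin \<eta> 0 y. bad_vertex r q G y) / card (nbrs G 0)" for \<eta>
          using fin unit_fieldD(3)[OF unit_field_bad_vertex[OF r]] by (simp add: avg_finite)
        ultimately have "deg G 0 * (bad_vertex r q G 0 * bad_average r q 1 G \<eta> 0)
            = (\<Sum>y\<in>nbrs G 0. of_bool (coin \<eta> 0 y))" for \<eta>
          using True fin bounded_degree_graphD(4)[OF elim(2), of 0]
          by (simp add: bad_average.simps(2) deg_eq_card)
        moreover have "integrable (perc_space q) (\<lambda>\<eta>. of_bool (coin \<eta> 0 y) :: real)" for y
          by (intro Q.integrable_const_bound[where B=1]) auto
        then have "(\<integral>\<eta>. (\<Sum>y\<in>nbrs G 0. of_bool (coin \<eta> 0 y) :: real) \<partial>perc_space q) = (\<Sum>y\<in>nbrs G 0. q)"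
          by (subst Bochner_Integration.integral_sum) (simp_all only: prob_coin[OF q])
        ultimately show ?thesis
          using True fin by (simp only:) (simp add: deg_eq_card Q.prob_space[simplified])
      qed (auto simp: bad_vertex_def)
    qed
    have m: "(\<lambda>(G, \<eta>). deg G 0 * (bad_vertex r q G 0 * bad_average r q 1 G \<eta> 0)) \<in> borel_measurable E"
      using int(1) by (simp add: case_prod_unfold)
    then show "(\<lambda>G. \<integral>\<eta>. deg G 0 * (bad_vertex r q G 0 * bad_average r q 1 G \<eta> 0) \<partial>perc_space q) \<in> borel_measurable \<mu>"
      by (rule Q.borel_measurable_lebesgue_integral)
    have "(\<lambda>(G, \<eta>). q * (deg G 0 * bad_vertex r q G 0)) \<in> borel_measurable E"
      using int(2) by (simp add: case_prod_unfold)
    then show "(\<lambda>G. \<integral>\<eta>. q * (deg G 0 * bad_vertex r q G 0) \<partial>perc_space q) \<in> borel_measurable \<mu>"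
      by (rule Q.borel_measurable_lebesgue_integral)
  qed
  also have "\<dots> = (\<integral>w. q * (deg (fst w) 0 * badv w) \<partial>E)"
    using P.integral_fst'[of "\<lambda>w. q * (deg (fst w) 0 * badv w)"] int(2) by simp
  finally show ?thesis by simp
qed

text \<open>As \<open>bada 0\<close> is \<open>1\<close>, twice the value
  \<open>1 / 2 + r / 6\<close> of the primitive at \<open>1\<close> contributes
  \<open>1 + r / 3\<close>, the product term takes off \<open>1\<close>, and replacing
  \<open>bada 1\<close> by \<open>1\<close> costs at most \<open>1 - bada 1\<close>, of mean
  \<open>1 - q\<close>. This is the origin of the condition \<open>1 - q < r / 3\<close>.\<close>

lemma energy_0_ge:
  assumes "0 < r"
  shows "(q - 1 + r / 3) * (\<integral>w. deg (fst w) 0 * badv w \<partial>E) \<le> (\<integral>w. energy 0 w \<partial>E)"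
proof -
  have bnd: "\<bar>badv w * bada 1 w\<bar> \<le> 1" "\<bar>badv w\<bar> \<le> 1" for w
    using bad_bounds by (auto intro!: mult_le_one)
  have int: "integrable E (\<lambda>w. deg (fst w) 0 * (badv w * bada 1 w))" "integrable E (\<lambda>w. deg (fst w) 0 * badv w)"
    by (rule integrable_deg_mult[OF _ bnd(1)], measurable) (rule integrable_deg_mult[OF _ bnd(2)], measurable)
  have "(q - 1 + r / 3) * (\<integral>w. deg (fst w) 0 * badv w \<partial>E)
      = (\<integral>w. deg (fst w) 0 * (badv w * bada 1 w) - (1 - r / 3) * (deg (fst w) 0 * badv w) \<partial>E)"
    using int by (simp add: mean_open_degree[OF assms, simplified] algebra_simps)
  also have "\<dots> \<le> (\<integral>w. energy 0 w \<partial>E)"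
  proof (rule integral_mono)
    show "integrable E (\<lambda>w. deg (fst w) 0 * (badv w * bada 1 w) - (1 - r / 3) * (deg (fst w) 0 * badv w))"
      using int by simp
    fix w
    \<comment> \<open>The tangent to the primitive at \<open>1\<close> has slope
      \<open>survival_map r 1 = 1\<close>.\<close>
    have "bada 1 w - 1 \<le> survival_primitive r (bada 1 w) - (1 / 2 + r / 6)"
      using survival_primitive_tangent[OF r, of 1 "bada 1 w"] bad_bounds(5,6)[of 1 w] by simp
    then have "deg (fst w) 0 * (badv w * (bada 1 w - (1 - r / 3)))
        \<le> deg (fst w) 0 * (badv w * (survival_primitive r (bada 1 w) + (1 / 2 + r / 6) - 1))"
      by (intro mult_left_mono deg_nonneg bad_bounds) simp
    then show "deg (fst w) 0 * (badv w * bada 1 w) - (1 - r / 3) * (deg (fst w) 0 * badv w) \<le> energy 0 w"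
      by (simp add: energy_def algebra_simps)
  qed (rule integrable_energy)
  finally show ?thesis .
qed

text \<open>Confinement only lowers a monotone iteration, and a further factor \<open>badv\<close>,
  with values \<open>0\<close> and \<open>1\<close>, leaves \<open>bads n\<close> unchanged.\<close>

lemma bad_survival_le: "AE w in E. bads n w \<le> badv w * survival r n (fst w) (snd w) 0"
proof -
  have le: "bad_survival r q n G \<eta> x \<le> survival r n G \<eta> x" if G: "\<And>x. finite (nbrs G x)" for G \<eta> x
  proof (induction n arbitrary: x)
    case 0
    then show ?case by (simp add: bad_vertex_def)
  next
    case (Suc n)
    note S = unit_field_survival[OF r] and B = unit_field_bad_survival[OF r, of q]
    have "survival_map r (avg G \<eta> (bad_survival r q n G \<eta>) x) \<le> survival_map r (avg G \<eta> (survival r n G \<eta>) x)"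
      by (intro survival_map_mono r avg_nonneg avg_mono G avg_le_1 unit_fieldD[OF S] unit_fieldD[OF B] Suc)
    moreover have "0 \<le> survival_map r (avg G \<eta> (survival r n G \<eta>) x)"
      by (intro survival_map_nonneg r avg_nonneg avg_le_1 unit_fieldD[OF S])
    ultimately show ?case by (auto simp: survival.simps(2) bad_survival.simps(2) bad_vertex_def)
  qed
  show ?thesis
    using bounded_degree_E
  proof eventually_elim
    case (elim w)
    have "bads n w = badv w * bads n w"
      unfolding bad_survival_eq by (simp add: bad_vertex_def)
    moreover have "badv w * bads n w \<le> badv w * survival r n (fst w) (snd w) 0"
      by (intro mult_left_mono le bounded_degree_graphD(2)[OF elim] bad_bounds)
    ultimately show ?case by linarith
  qed
qed

text \<open>Integrating over the coins first bounds the mean by that of \<open>badv\<close> times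
  \<open>mean_survival\<close>. At a bad root \<open>mean_survival\<close> decreases to
  \<open>0\<close>, and dominated convergence applies.\<close>

lemma integral_bad_survival_tendsto: "(\<lambda>n. \<integral>w. bads n w \<partial>E) \<longlonglongrightarrow> 0"
proof -
  note S = unit_field_survival[OF r] and M = unit_field_mean_survival[OF r, of q]
  let ?f = "\<lambda>n G. bad_vertex r q G 0 * mean_survival r q n G 0"
  have [measurable]: "(\<lambda>w. survival r n (fst w) (snd w) 0) \<in> borel_measurable E" for n
    by (rule unit_field_measurable[OF S])
  have int: "integrable E (\<lambda>w. badv w * survival r n (fst w) (snd w) 0)" for n
    using bad_bounds(1,2) unit_fieldD(3,4)[OF S]
    by (intro E.integrable_const_bound[where B=1]) (auto intro!: mult_le_one)
  have m: "(\<lambda>G. bad_vertex r q G 0) \<in> borel_measurable \<mu>" "(\<lambda>G. mean_survival r q n G 0) \<in> borel_measurable \<mu>" for n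
    using measurable_compose[OF measurable_Pair2'[of all_open] unit_fieldD(2)[OF unit_field_bad_vertex[OF r, of q], of 0]]
      measurable_compose[OF measurable_Pair2'[of all_open] unit_fieldD(2)[OF M, of n 0]]
    by (simp_all add: measurable_mu)
  have "(\<lambda>n. \<integral>G. ?f n G \<partial>\<mu>) \<longlonglongrightarrow> (\<integral>G. 0 \<partial>\<mu>)"
  proof (rule integral_dominated_convergence[where w="\<lambda>_. 1"])
    show "AE G in \<mu>. (\<lambda>n. ?f n G) \<longlonglongrightarrow> 0"
      using bounded_degree
    proof eventually_elim
      case (elim G)
      have lim: "(\<lambda>n. mean_survival r q n G 0) \<longlonglongrightarrow> (INF n. mean_survival r q n G 0)"
        using unit_field_bdd(1)[of "\<lambda>n G \<eta>. mean_survival r q n G"] M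
        by (intro LIMSEQ_decseq_INF decseq_mean_survival r bounded_degree_graphD(2)[OF elim]) auto
      show ?case
      proof (cases "limit_goodness r q G 0 = 0")
        \<comment> \<open>The infimum of \<open>mean_survival\<close> is \<open>goodness\<close> at
          step \<open>0\<close>, hence lies between \<open>0\<close> and the limit of
          \<open>goodness\<close>.\<close>
        case True
        then have "(INF n. mean_survival r q n G 0) = 0"
          using goodness_le_limit[OF r, of q 0 G 0] unit_fieldD(3)[OF unit_field_goodness[OF r, of q 0], of G 0]
          by simp
        with lim show ?thesis by (simp add: bad_vertex_def)
      qed (simp add: bad_vertex_def)
    qed
    show "AE G in \<mu>. norm (?f n G) \<le> 1" for n
      using unit_fieldD(3,4)[OF unit_field_bad_vertex[OF r, of q]] unit_fieldD(3,4)[OF M]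
      by (auto intro!: AE_I2 mult_le_one)
  qed (auto intro!: m borel_measurable_times)
  moreover have "(\<integral>w. bads n w \<partial>E) \<le> (\<integral>G. ?f n G \<partial>\<mu>)" for n
  proof -
    have "integrable E (bads n)"
      using bad_bounds(3,4) by (intro E.integrable_const_bound[where B=1]) auto
    then have "(\<integral>w. bads n w \<partial>E) \<le> (\<integral>w. badv w * survival r n (fst w) (snd w) 0 \<partial>E)"
      by (intro integral_mono_AE int bad_survival_le)
    also have "\<dots> = (\<integral>G. ?f n G \<partial>\<mu>)"
      using P.integral_fst'[OF int[of n]] by (simp add: mean_survival_def)
    finally show ?thesis .
  qed
  moreover have "0 \<le> (\<integral>w. bads n w \<partial>E)" for n
    using bad_bounds(3) by simp
  ultimately show ?thesis
    by (intro tendsto_sandwich[of "\<lambda>_. 0"  "\<lambda>n. \<integral>w. bads n w \<partial>E"  sequentially "\<lambda>n. \<integral>G. ?f n G \<partial>\<mu>"]) auto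
qed

text \<open>On the unit interval the primitive is at most \<open>t\<close>, which is at most
  \<open>survival_map r t\<close>; so each primitive term is dominated by the corresponding
  \<open>bads\<close>, and the subtracted product is nonnegative.\<close>

lemma energy_le: "(\<integral>w. energy n w \<partial>E) \<le> D * ((\<integral>w. bads (Suc n) w \<partial>E) + (\<integral>w. bads n w \<partial>E))"
proof -
  have int: "integrable E (bads n)" for n
    using bad_bounds(3,4) by (intro E.integrable_const_bound[where B=1]) auto
  have le: "badv w * survival_primitive r (bada m w) \<le> bads m w" for m w
    unfolding bad_survival_eq
    using survival_primitive_bounds(2)[OF r bad_bounds(5,6)] survival_map_ge[OF r bad_bounds(5,6)]
    by (intro mult_left_mono bad_bounds) (rule order_trans)
  have "(\<integral>w. energy n w \<partial>E) \<le> (\<integral>w. D * (bads (Suc n) w + bads n w) \<partial>E)"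
  proof (rule integral_mono_AE)
    show "integrable E (\<lambda>w. D * (bads (Suc n) w + bads n w))"
      using int by simp
    show "AE w in E. energy n w \<le> D * (bads (Suc n) w + bads n w)"
      using bounded_degree_E
    proof eventually_elim
      case (elim w)
      have "badv w * (survival_primitive r (bada (Suc n) w) + survival_primitive r (bada n w)) - bads n w * bada n w
          \<le> bads (Suc n) w + bads n w"
        using le[of w "Suc n"] le[of w n] mult_nonneg_nonneg[OF bad_bounds(3)[of n w] bad_bounds(5)[of n w]]
        by (simp add: distrib_left)
      then have "energy n w \<le> deg (fst w) 0 * (bads (Suc n) w + bads n w)"
        unfolding energy_def by (intro mult_left_mono deg_nonneg)
      also have "\<dots> \<le> D * (bads (Suc n) w + bads n w)"
        using bounded_degree_deg[OF elim, of 0] bad_bounds by (intro mult_right_mono add_nonneg_nonneg) auto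
      finally show ?case .
    qed
  qed (rule integrable_energy)
  then show ?thesis
    using int by simp
qed

text \<open>The initial energy is at most every later one, and those are bounded by quantities
  tending to \<open>0\<close>. But it is also at least a positive multiple of the degree-weighted
  mass of bad roots, which must therefore vanish; the zero-one law leaves only the value
  \<open>1\<close>.\<close>

theorem limit_goodness_eq_1:
  assumes "0 < r" "1 - q < r / 3"
  shows "AE G in \<mu>. limit_goodness r q G 0 = 1"
proof -
  have bnd: "\<bar>badv w\<bar> \<le> 1" for w :: "graph \<times> coins"
    using bad_bounds(1,2)[of w] by auto
  have int: "integrable E (\<lambda>w. deg (fst w) 0 * badv w)"
    by (rule integrable_deg_mult[OF _ bnd]) measurable
  have "(\<integral>w. energy 0 w \<partial>E) \<le> (\<integral>w. energy n w \<partial>E)" for n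
    by (induction n) (auto intro: order_trans energy_mono)
  then have "(\<integral>w. energy 0 w \<partial>E) \<le> D * ((\<integral>w. bads (Suc n) w \<partial>E) + (\<integral>w. bads n w \<partial>E))" for n
    using energy_le order_trans by blast
  moreover have "(\<lambda>n. D * ((\<integral>w. bads (Suc n) w \<partial>E) + (\<integral>w. bads n w \<partial>E))) \<longlonglongrightarrow> real D * (0 + 0)"
    by (intro tendsto_intros integral_bad_survival_tendsto LIMSEQ_Suc)
  ultimately have "(\<integral>w. energy 0 w \<partial>E) \<le> 0"
    by (intro LIMSEQ_le_const[where X="\<lambda>n. D * ((\<integral>w. bads (Suc n) w \<partial>E) + (\<integral>w. bads n w \<partial>E))"]) auto
  then have "(q - 1 + r / 3) * (\<integral>w. deg (fst w) 0 * badv w \<partial>E) \<le> 0"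
    using energy_0_ge[OF assms(1)] by linarith
  then have "(\<integral>w. deg (fst w) 0 * badv w \<partial>E) \<le> 0"
    using assms(2) by (simp add: mult_le_0_iff)
  moreover have nn: "0 \<le> deg (fst w) 0 * badv w" for w :: "graph \<times> coins"
    by (intro mult_nonneg_nonneg deg_nonneg bad_bounds)
  ultimately have "(\<integral>w. deg (fst w) 0 * badv w \<partial>E) = 0"
    by (intro antisym) auto
  then have "AE w in E. deg (fst w) 0 * badv w = 0"
    using int nn by (subst (asm) integral_nonneg_eq_0_iff_AE) auto
  then have "AE w in E. limit_goodness r q (fst w) 0 = 1"
    using bounded_degree_E limit_goodness_zero_one[OF assms(1)]
  proof eventually_elim
    case (elim w)
    then show ?case
      using bounded_degree_deg(1)[OF elim(2), of 0] by (auto simp: bad_vertex_def split: if_splits)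
  qed
  then show ?thesis
    by (rule AE_mu_fst)
qed

end

section \<open>Transient branching walks\<close>

text \<open>Infinite clusters are expressed by countable quantifiers: vertices beyond every bound
  are reached by open paths of finite length. Measurability is joint in graph and coins so that it
  can later be applied to a random trace.\<close>

lemma perc_event_measurable:
  "{w. snd w \<in> perc_event (fst w)} \<in> sets (graph_space \<Otimes>\<^sub>M graph_space)"
proof -
  let ?R = "\<lambda>w. open_edges (fst w) (snd w)"
  have [measurable]: "Measurable.pred (graph_space \<Otimes>\<^sub>M graph_space) (\<lambda>w. (x, y) \<in> ?R w)" for x y
    unfolding open_edges_def by simp
  have [measurable]: "Measurable.pred (graph_space \<Otimes>\<^sub>M graph_space) (\<lambda>w. (x, y) \<in> ?R w ^^ n)" for x y n
  proof (induction n arbitrary: y)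
    case (Suc n)
    note [measurable] = Suc
    have "(x, y) \<in> ?R w ^^ Suc n \<longleftrightarrow> (\<exists>z. (x, z) \<in> ?R w ^^ n \<and> (z, y) \<in> ?R w)" for w
      by auto
    then show ?case by simp
  qed simp
  have "{w. snd w \<in> perc_event (fst w)} = {w \<in> space (graph_space \<Otimes>\<^sub>M graph_space).
      \<exists>x. \<forall>m. \<exists>y>m. \<exists>n. (x, y) \<in> ?R w ^^ n}"
    by (auto simp: perc_event_def infinite_nat_iff_unbounded rtrancl_power space_pair_measure)
  also have "\<dots> \<in> sets (graph_space \<Otimes>\<^sub>M graph_space)"
    by measurable
  finally show ?thesis .
qed

lemma perc_event_sets: "perc_event H \<in> sets (perc_space q)"
  using sets_Pair1[OF perc_event_measurable, of H] by (simp add: sets_perc_space vimage_def)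

lemma open_edges_mono: "(\<And>e. H e \<Longrightarrow> H' e) \<Longrightarrow> open_edges H \<eta> \<subseteq> open_edges H' \<eta>"
  by (auto simp: open_edges_def)

lemma perc_event_mono: "(\<And>e. H e \<Longrightarrow> H' e) \<Longrightarrow> perc_event H \<subseteq> perc_event H'"
proof
  fix \<eta> assume H: "\<And>e. H e \<Longrightarrow> H' e" and "\<eta> \<in> perc_event H"
  then obtain x where "infinite {y. (x, y) \<in> (open_edges H \<eta>)\<^sup>*}"
    by (auto simp: perc_event_def)
  moreover have "(open_edges H \<eta>)\<^sup>* \<subseteq> (open_edges H' \<eta>)\<^sup>*"
    using H by (intro rtrancl_mono open_edges_mono)
  ultimately have "infinite {y. (x, y) \<in> (open_edges H' \<eta>)\<^sup>*}"
    by (auto elim!: infinite_super[rotated])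
  then show "\<eta> \<in> perc_event H'"
    by (auto simp: perc_event_def)
qed

section \<open>Branching walks from an arbitrary vertex\<close>

abbreviation label_space :: "nat pmf \<Rightarrow> (nat \<times> real) measure" where
  "label_space p \<equiv> measure_pmf p \<Otimes>\<^sub>M uniform_measure lborel {0..<1}"

text \<open>Labels grow at the front, so the subtree of the child \<open>i\<close> of the root
  consists of the labels that end in \<open>i\<close>.\<close>

definition shift :: "nat \<Rightarrow> brw_sample \<Rightarrow> brw_sample" where
  "shift i \<omega> = (\<lambda>w. \<omega> (w @ [i]))"

fun walk :: "graph \<Rightarrow> nat \<Rightarrow> brw_sample \<Rightarrow> nat list \<Rightarrow> nat" where
  "walk G x \<omega> [] = x"
| "walk G x \<omega> (i # w) = srw_step G (walk G x \<omega> w) (snd (\<omega> (i # w)))"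

definition transient_from :: "graph \<Rightarrow> nat \<Rightarrow> brw_sample \<Rightarrow> bool" where
  "transient_from G x \<omega> \<longleftrightarrow> (\<forall>y. finite {v \<in> gw_tree \<omega>. walk G x \<omega> v = y})"

definition trace_from :: "graph \<Rightarrow> nat \<Rightarrow> brw_sample \<Rightarrow> graph" where
  "trace_from G x \<omega> = (\<lambda>(a, b). \<exists>i w. i # w \<in> gw_tree \<omega> \<and>
      ((walk G x \<omega> w = a \<and> walk G x \<omega> (i # w) = b) \<or>
       (walk G x \<omega> w = b \<and> walk G x \<omega> (i # w) = a)))"

lemma walk_0: "walk G 0 \<omega> v = brw_pos G \<omega> v"
  by (induction v) auto

lemma transient_from_0: "transient_from G 0 = transient_sample G"
  by (simp add: transient_from_def transient_sample_def walk_0 fun_eq_iff)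

lemma trace_from_0: "trace_from G 0 = trace G"
  by (simp add: trace_from_def trace_def walk_0 fun_eq_iff del: walk.simps(2) brw_pos.simps(2))

lemma gw_tree_Nil [simp]: "[] \<in> gw_tree \<omega>"
  by (rule gw_tree.root)

lemma gw_tree_Cons [simp]: "i # w \<in> gw_tree \<omega> \<longleftrightarrow> w \<in> gw_tree \<omega> \<and> i < fst (\<omega> w)"
  by (auto intro: gw_tree.child elim: gw_tree.cases)

lemma shift_Nil [simp]: "shift i \<omega> [] = \<omega> [i]"
  by (simp add: shift_def)

lemma walk_snoc:
  "walk G x \<omega> (w @ [i]) = walk G (srw_step G x (snd (\<omega> [i]))) (shift i \<omega>) w"
  by (induction w) (auto simp: shift_def)

lemma gw_tree_snoc: "w @ [i] \<in> gw_tree \<omega> \<longleftrightarrow> i < fst (\<omega> []) \<and> w \<in> gw_tree (shift i \<omega>)"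
  by (induction w) (auto simp: shift_def)

lemma transient_from_shift:
  assumes "transient_from G x \<omega>" "i < fst (\<omega> [])"
  shows "transient_from G (srw_step G x (snd (\<omega> [i]))) (shift i \<omega>)"
  unfolding transient_from_def
proof
  fix y
  let ?S = "{v \<in> gw_tree (shift i \<omega>). walk G (srw_step G x (snd (\<omega> [i]))) (shift i \<omega>) v = y}"
  have "(\<lambda>v. v @ [i]) ` ?S \<subseteq> {v \<in> gw_tree \<omega>. walk G x \<omega> v = y}"
    using assms(2) by (auto simp: gw_tree_snoc walk_snoc)
  then have "finite ((\<lambda>v. v @ [i]) ` ?S)"
    using assms(1) finite_subset unfolding transient_from_def by blast
  then show "finite ?S"
    by (rule finite_imageD) (auto simp: inj_on_def)
qed

lemma trace_from_shift:
  assumes "trace_from G (srw_step G x (snd (\<omega> [i]))) (shift i \<omega>) e" "i < fst (\<omega> [])"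
  shows "trace_from G x \<omega> e"
proof -
  obtain a b j w where e: "e = (a, b)" and w: "j # w \<in> gw_tree (shift i \<omega>)" and
    "walk G (srw_step G x (snd (\<omega> [i]))) (shift i \<omega>) w = a \<and>
        walk G (srw_step G x (snd (\<omega> [i]))) (shift i \<omega>) (j # w) = b \<or>
     walk G (srw_step G x (snd (\<omega> [i]))) (shift i \<omega>) w = b \<and>
        walk G (srw_step G x (snd (\<omega> [i]))) (shift i \<omega>) (j # w) = a"
    using assms(1) unfolding trace_from_def by (cases e) auto
  moreover have "j # (w @ [i]) \<in> gw_tree \<omega>"
    using gw_tree_snoc[of "j # w" i \<omega>] w assms(2) by simp
  ultimately show ?thesis
    using walk_snoc[of G x \<omega> w i] walk_snoc[of G x \<omega> "j # w" i]
    unfolding trace_from_def e by (simp only: prod.case append_Cons) blast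
qed

text \<open>The uniform variable at the root label drives no step. In a shifted sample it holds the
  step into the child, which is therefore independent of what happens in the subtree of that
  child.\<close>

lemma root_step_irrelevant:
  assumes "\<And>v. fst (\<omega>' v) = fst (\<omega> v)" "\<And>v. v \<noteq> [] \<Longrightarrow> \<omega>' v = \<omega> v"
  shows "walk G x \<omega>' v = walk G x \<omega> v" "gw_tree \<omega>' = gw_tree \<omega>"
    "transient_from G x \<omega>' = transient_from G x \<omega>" "trace_from G x \<omega>' = trace_from G x \<omega>"
proof -
  show w: "walk G x \<omega>' v = walk G x \<omega> v" for v
    by (induction v) (auto simp: assms(2))
  have "v \<in> gw_tree \<omega>' \<longleftrightarrow> v \<in> gw_tree \<omega>" for v
    by (induction v) (auto simp: assms(1))
  then show t: "gw_tree \<omega>' = gw_tree \<omega>" by blast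
  show "transient_from G x \<omega>' = transient_from G x \<omega>" "trace_from G x \<omega>' = trace_from G x \<omega>"
    by (simp_all add: transient_from_def trace_from_def w t del: walk.simps(2))
qed

text \<open>The coins belong to edges of the graph, so particles crossing the same edge see the same
  coin; given the coins, the subtrees of the children evolve independently. The recursion over the
  first generation mirrors that of \<open>survival\<close>.\<close>

primrec alive :: "graph \<Rightarrow> coins \<Rightarrow> nat \<Rightarrow> nat \<Rightarrow> brw_sample \<Rightarrow> bool" where
  "alive G \<eta> 0 x \<omega> \<longleftrightarrow> True"
| "alive G \<eta> (Suc n) x \<omega> \<longleftrightarrow> (\<exists>i<fst (\<omega> []). coin \<eta> x (srw_step G x (snd (\<omega> [i]))) \<and>
      alive G \<eta> n (srw_step G x (snd (\<omega> [i]))) (shift i \<omega>))"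

lemma alive_Suc_imp: "alive G \<eta> (Suc n) x \<omega> \<Longrightarrow> alive G \<eta> n x \<omega>"
proof (induction n arbitrary: x \<omega>)
  case (Suc n)
  then show ?case
    unfolding alive.simps(2)[of G \<eta> "Suc n"] alive.simps(2)[of G \<eta> n] by blast
qed simp

text \<open>The first open step is an edge of the trace, and the trace of the subtree of a child is
  contained in the whole trace, so an open line of descent is a path of open edges of the
  trace.\<close>

lemma alive_open_path:
  assumes "alive G \<eta> n x \<omega>"
  shows "\<exists>w\<in>gw_tree \<omega>. length w = n \<and> (x, walk G x \<omega> w) \<in> (open_edges (trace_from G x \<omega>) \<eta>)\<^sup>*"
  using assms
proof (induction n arbitrary: x \<omega>)
  case (Suc n)
  then obtain i where i: "i < fst (\<omega> [])" and
    open_step: "coin \<eta> x (srw_step G x (snd (\<omega> [i])))" and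
    al: "alive G \<eta> n (srw_step G x (snd (\<omega> [i]))) (shift i \<omega>)" by auto
  let ?y = "srw_step G x (snd (\<omega> [i]))"
  obtain w where w: "w \<in> gw_tree (shift i \<omega>)" "length w = n"
    "(?y, walk G ?y (shift i \<omega>) w) \<in> (open_edges (trace_from G ?y (shift i \<omega>)) \<eta>)\<^sup>*"
    using Suc.IH[OF al] by blast
  have "open_edges (trace_from G ?y (shift i \<omega>)) \<eta> \<subseteq> open_edges (trace_from G x \<omega>) \<eta>"
    using trace_from_shift i by (intro open_edges_mono)
  then have "(?y, walk G x \<omega> (w @ [i])) \<in> (open_edges (trace_from G x \<omega>) \<eta>)\<^sup>*"
    using w(3) rtrancl_mono unfolding walk_snoc by blast
  moreover have "trace_from G x \<omega> (x, ?y)"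
    unfolding trace_from_def using i by (auto intro!: exI[of _ i] exI[of _ "[]"])
  then have "(x, ?y) \<in> open_edges (trace_from G x \<omega>) \<eta>"
    using open_step by (simp add: open_edges_def coin_def)
  ultimately have "(x, walk G x \<omega> (w @ [i])) \<in> (open_edges (trace_from G x \<omega>) \<eta>)\<^sup>*"
    by (rule converse_rtrancl_into_rtrancl[rotated])
  then show ?case
    using w i by (intro bexI[of _ "w @ [i]"]) (auto simp: gw_tree_snoc)
qed auto

text \<open>A transient walk visits a finite cluster finitely often, so an infinite line of descent along
  open edges forces an infinite open cluster.\<close>
lemma alive_forever_percolates:
  assumes tr: "transient_from G x \<omega>" and al: "\<And>n. alive G \<eta> n x \<omega>"
  shows "\<eta> \<in> perc_event (trace_from G x \<omega>)"
proof (rule ccontr)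
  let ?C = "{y. (x, y) \<in> (open_edges (trace_from G x \<omega>) \<eta>)\<^sup>*}"
  assume "\<eta> \<notin> perc_event (trace_from G x \<omega>)"
  then have "finite ?C" by (auto simp: perc_event_def)
  then have "finite (\<Union>y\<in>?C. {v \<in> gw_tree \<omega>. walk G x \<omega> v = y})"
    using tr unfolding transient_from_def by (intro finite_UN_I) auto
  then have "finite (length ` (\<Union>y\<in>?C. {v \<in> gw_tree \<omega>. walk G x \<omega> v = y}))"
    by (rule finite_imageI)
  moreover have all: "n \<in> length ` (\<Union>y\<in>?C. {v \<in> gw_tree \<omega>. walk G x \<omega> v = y})" for n
    using alive_open_path[OF al[of n]] by auto
  ultimately show False
    using UNIV_eq_I[OF all] infinite_UNIV_nat by simp
qed

text \<open>With transience as a premise, goodness passes from a child to its parent: transience is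
  inherited by subtrees, and percolation of the trace of a subtree implies that of the whole
  trace.\<close>

definition good :: "real \<Rightarrow> graph \<Rightarrow> nat \<Rightarrow> brw_sample \<Rightarrow> bool" where
  "good q G x \<omega> \<longleftrightarrow> (transient_from G x \<omega> \<longrightarrow> 0 < measure (perc_space q) (perc_event (trace_from G x \<omega>)))"

lemma good_shift:
  assumes "i < fst (\<omega> [])" "good q G (srw_step G x (snd (\<omega> [i]))) (shift i \<omega>)"
  shows "good q G x \<omega>"
  unfolding good_def
proof
  interpret Q: prob_space "perc_space q" by (rule prob_space_perc_space)
  assume "transient_from G x \<omega>"
  then have "0 < measure (perc_space q) (perc_event (trace_from G (srw_step G x (snd (\<omega> [i]))) (shift i \<omega>)))"
    using transient_from_shift assms by (auto simp: good_def)
  also have "\<dots> \<le> measure (perc_space q) (perc_event (trace_from G x \<omega>))"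
    using trace_from_shift assms(1) by (intro Q.finite_measure_mono perc_event_mono perc_event_sets)
  finally show "0 < measure (perc_space q) (perc_event (trace_from G x \<omega>))" .
qed

section \<open>Measurability of the events of the branching walk\<close>

lemma prob_space_uniform: "prob_space (uniform_measure lborel {0..<1::real})"
  by (rule prob_space_uniform_measure) auto

lemma prob_space_label: "prob_space (label_space p)"
  by (intro prob_space_pair prob_space_measure_pmf prob_space_uniform)

lemma prob_space_brw_space: "prob_space (brw_space p)"
  unfolding brw_space_def by (intro prob_space_PiM_UNIV prob_space_label)

lemma space_brw_space [simp]: "space (brw_space p) = UNIV"
  by (simp add: brw_space_def space_PiM space_pair_measure)

lemma measurable_label [measurable]:
  "(\<lambda>\<omega>. fst (\<omega> v)) \<in> brw_space p \<rightarrow>\<^sub>M count_space UNIV"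
  "(\<lambda>\<omega>. snd (\<omega> v)) \<in> borel_measurable (brw_space p)"
proof -
  have 1: "(\<lambda>\<omega>. \<omega> v) \<in> brw_space p \<rightarrow>\<^sub>M label_space p"
    unfolding brw_space_def by simp
  have "fst \<in> label_space p \<rightarrow>\<^sub>M count_space UNIV"
    using measurable_fst[of "measure_pmf p" "uniform_measure lborel {0..<1::real}"] by simp
  from measurable_compose[OF 1 this] show "(\<lambda>\<omega>. fst (\<omega> v)) \<in> brw_space p \<rightarrow>\<^sub>M count_space UNIV" .
  have "snd \<in> borel_measurable (label_space p)"
    using measurable_snd[of "measure_pmf p" "uniform_measure lborel {0..<1::real}"]
    by (simp cong: measurable_cong_sets)
  from measurable_compose[OF 1 this] show "(\<lambda>\<omega>. snd (\<omega> v)) \<in> borel_measurable (brw_space p)" .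
qed

lemma measurable_shift [measurable]: "shift i \<in> brw_space p \<rightarrow>\<^sub>M brw_space p"
  unfolding brw_space_def shift_def[abs_def]
  by (rule measurable_PiM_single') (auto simp: space_PiM space_pair_measure)

lemma distr_shift: "distr (brw_space p) (brw_space p) (shift i) = brw_space p"
  unfolding brw_space_def shift_def[abs_def]
  by (intro distr_PiM_UNIV_reindex prob_space_label) (auto simp: inj_def)

lemma measurable_srw_step [measurable]: "srw_step G x \<in> borel \<rightarrow>\<^sub>M count_space UNIV"
  unfolding srw_step_def[abs_def] by measurable

lemma measurable_srw_step_label [measurable]:
  "(\<lambda>\<omega>. srw_step G x (snd (\<omega> v))) \<in> brw_space p \<rightarrow>\<^sub>M count_space UNIV"
  by (rule measurable_compose[OF measurable_label(2) measurable_srw_step])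

lemma measurable_walk [measurable]: "(\<lambda>\<omega>. walk G x \<omega> v) \<in> brw_space p \<rightarrow>\<^sub>M count_space UNIV"
proof (induction v)
  case (Cons i v)
  then show ?case
    by (simp add: measurable_compose_countable[where f="\<lambda>y \<omega>. srw_step G y (snd (\<omega> (i # v)))" and g="\<lambda>\<omega>. walk G x \<omega> v"])
qed simp

lemma measurable_gw_tree [measurable]: "Measurable.pred (brw_space p) (\<lambda>\<omega>. v \<in> gw_tree \<omega>)"
  by (induction v) auto

lemma measurable_transient_from [measurable]: "Measurable.pred (brw_space p) (transient_from G x)"
proof -
  \<comment> \<open>Finite sets of labels are covered by lists, of which there are only countably
    many.\<close>
  have "finite {v \<in> gw_tree \<omega>. walk G x \<omega> v = y} \<longleftrightarrow>
     (\<exists>L. \<forall>v. v \<in> gw_tree \<omega> \<and> walk G x \<omega> v = y \<longrightarrow> v \<in> set L)" for \<omega> y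
  proof
    assume "finite {v \<in> gw_tree \<omega>. walk G x \<omega> v = y}"
    then obtain L where "set L = {v \<in> gw_tree \<omega>. walk G x \<omega> v = y}"
      using finite_list by blast
    then show "\<exists>L. \<forall>v. v \<in> gw_tree \<omega> \<and> walk G x \<omega> v = y \<longrightarrow> v \<in> set L" by blast
  next
    assume "\<exists>L. \<forall>v. v \<in> gw_tree \<omega> \<and> walk G x \<omega> v = y \<longrightarrow> v \<in> set L"
    then show "finite {v \<in> gw_tree \<omega>. walk G x \<omega> v = y}"
      by (auto intro: finite_subset[OF _ finite_set])
  qed
  then show ?thesis
    unfolding transient_from_def[abs_def] by simp
qed

lemma measurable_trace_from [measurable]: "trace_from G x \<in> brw_space p \<rightarrow>\<^sub>M graph_space"
  unfolding graph_space_def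
proof (rule measurable_PiM_single')
  fix e :: "nat \<times> nat"
  show "(\<lambda>\<omega>. trace_from G x \<omega> e) \<in> brw_space p \<rightarrow>\<^sub>M count_space UNIV"
    unfolding trace_from_def by (cases e) (simp del: walk.simps(2) gw_tree_Cons)
qed auto

text \<open>Slices of the jointly measurable percolation event have a probability that is measurable
  in the graph; this is composed with the measurable map from a sample to its trace.\<close>

lemma measurable_good [measurable]: "Measurable.pred (brw_space p) (good q G x)"
proof -
  interpret Q: prob_space "perc_space q" by (rule prob_space_perc_space)
  have "{w. snd w \<in> perc_event (fst w)} \<in> sets (graph_space \<Otimes>\<^sub>M perc_space q)"
    using perc_event_measurable by (simp cong: sets_pair_measure_cong add: sets_perc_space)
  from Q.measurable_emeasure_Pair[OF this]
  have "(\<lambda>H. emeasure (perc_space q) (perc_event H)) \<in> borel_measurable graph_space"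
    by (simp add: vimage_def)
  from measurable_compose[OF measurable_trace_from this]
  have [measurable]: "(\<lambda>\<omega>. measure (perc_space q) (perc_event (trace_from G x \<omega>))) \<in> borel_measurable (brw_space p)"
    unfolding measure_def by measurable
  show ?thesis
    unfolding good_def[abs_def] by measurable
qed

lemma measurable_alive:
  "Measurable.pred (brw_space p \<Otimes>\<^sub>M graph_space) (\<lambda>w. alive G (snd w) n x (fst w))"
proof (induction n arbitrary: x)
  case (Suc n)
  have [measurable]: "Measurable.pred (brw_space p \<Otimes>\<^sub>M graph_space) (\<lambda>w. alive G (snd w) n x (shift i (fst w)))" for x i
    using measurable_compose[OF _ Suc[of x], of "\<lambda>w. (shift i (fst w), snd w)"] by simp
  have [measurable]: "Measurable.pred (brw_space p \<Otimes>\<^sub>M graph_space) (\<lambda>w. srw_step G x (snd (fst w v)) = y)" for v y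
    by (intro pred_eq_const1[where N="count_space UNIV"] measurable_compose[OF measurable_fst measurable_srw_step_label]) auto
  have [measurable]: "Measurable.pred (brw_space p \<Otimes>\<^sub>M graph_space) (\<lambda>w. i < fst (fst w []))" for i
    using measurable_compose[OF measurable_fst[of "brw_space p" graph_space] measurable_label(1)[of "[]" p]] by measurable
  \<comment> \<open>Quantifying over the endpoint \<open>y\<close> of the step removes the random
    vertex from \<open>alive\<close>.\<close>
  have "alive G (snd w) (Suc n) x (fst w) \<longleftrightarrow> (\<exists>i y. i < fst (fst w []) \<and> srw_step G x (snd (fst w [i])) = y \<and>
      coin (snd w) x y \<and> alive G (snd w) n y (shift i (fst w)))" for w
    by auto
  then show ?case by simp
qed simp

section \<open>Percolation of the trace\<close>

lemma prob_offspring: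
  "measure (brw_space p) {\<omega>. fst (\<omega> v) \<in> A} = measure (measure_pmf p) A"
proof -
  interpret U: prob_space "uniform_measure lborel {0..<1::real}" by (rule prob_space_uniform)
  have d: "distr (brw_space p) (label_space p) (\<lambda>\<omega>. \<omega> v) = label_space p"
    unfolding brw_space_def by (intro distr_PiM_component prob_space_label) auto
  have "measure (brw_space p) {\<omega>. fst (\<omega> v) \<in> A} = measure (label_space p) (A \<times> UNIV)"
    by (subst d[symmetric], subst measure_distr) (simp_all add: brw_space_def space_PiM space_pair_measure vimage_def mem_Times_iff)
  also have "\<dots> = measure (measure_pmf p) A"
    using U.emeasure_pair_measure_Times[of A "measure_pmf p" UNIV] U.emeasure_space_1
    by (simp add: measure_def)
  finally show ?thesis .
qed

lemma prob_offspring_step: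
  assumes "0 \<le> a" "a \<le> b" "b \<le> 1"
  shows "measure (brw_space p) {\<omega>. fst (\<omega> v) = k \<and> snd (\<omega> v) \<in> {a..<b}} = pmf p k * (b - a)"
proof -
  interpret U: prob_space "uniform_measure lborel {0..<1::real}" by (rule prob_space_uniform)
  have d: "distr (brw_space p) (label_space p) (\<lambda>\<omega>. \<omega> v) = label_space p"
    unfolding brw_space_def by (intro distr_PiM_component prob_space_label) auto
  have "measure (brw_space p) {\<omega>. fst (\<omega> v) = k \<and> snd (\<omega> v) \<in> {a..<b}} = measure (label_space p) ({k} \<times> {a..<b})"
    by (subst d[symmetric], subst measure_distr) (simp_all add: brw_space_def space_PiM space_pair_measure vimage_def mem_Times_iff)
  also have "\<dots> = pmf p k * measure (uniform_measure lborel {0..<1}) {a..<b}"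
    using U.emeasure_pair_measure_Times[of "{k}" "measure_pmf p" "{a..<b}"]
    by (simp add: measure_def enn2real_mult emeasure_pmf_single)
  also have "{0..<1} \<inter> {a..<b} = {a..<b}"
    using assms by auto
  then have "measure (uniform_measure lborel {0..<1}) {a..<b} = b - a"
    using assms by (subst measure_uniform_measure) auto
  finally show ?thesis .
qed

lemma srw_step_eq:
  assumes "j < card (nbrs G x)" "finite (nbrs G x)"
    and "u \<in> {j / card (nbrs G x) ..< (j + 1) / card (nbrs G x)}"
  shows "srw_step G x u = sorted_list_of_set (nbrs G x) ! j"
proof -
  have "\<lfloor>u * card (nbrs G x)\<rfloor> = int j"
    using assms by (intro floor_unique) (auto simp: field_simps)
  then show ?thesis by (simp add: srw_step_def)
qed

text \<open>Through the root label, \<open>A\<close> sees only the number of children. Once this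
  number is fixed, \<open>A\<close> is an event of the other labels, independent of the uniform
  variable at the root; summing over the number gives the claim.\<close>

lemma prob_first_step:
  assumes A: "A \<in> sets (brw_space p)" and ab: "0 \<le> a" "a \<le> b" "b \<le> 1"
    and irr: "\<And>\<omega> u. fun_upd \<omega> [] (fst (\<omega> []), u) \<in> A \<longleftrightarrow> \<omega> \<in> A"
  shows "measure (brw_space p) ({\<omega>. snd (\<omega> []) \<in> {a..<b}} \<inter> A) = (b - a) * measure (brw_space p) A"
proof -
  interpret B: prob_space "brw_space p" by (rule prob_space_brw_space)
  let ?I = "{\<omega>. snd (\<omega> []) \<in> {a..<b}}" and ?X = "\<lambda>k. {\<omega>. fst (\<omega> []) = k}"
  \<comment> \<open>The root label is frozen at \<open>k\<close> children; the value
    \<open>0\<close> of the uniform variable is immaterial by \<open>irr\<close>.\<close>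
  define A' where "A' k = {\<omega>. fun_upd \<omega> [] (k, 0) \<in> A}" for k
  have [measurable]: "(\<lambda>\<omega>. fun_upd \<omega> [] (k, 0)) \<in> brw_space p \<rightarrow>\<^sub>M brw_space p" for k
    unfolding brw_space_def by (rule measurable_PiM_single') (auto simp: space_PiM space_pair_measure)
  have [measurable]: "A' k \<in> sets (brw_space p)" for k
    using measurable_sets[OF _ A, of "\<lambda>\<omega>. (fun_upd \<omega> [] (k, 0))" "brw_space p"] by (simp add: A'_def vimage_def)
  have X [measurable]: "?X k \<in> sets (brw_space p)" for k
    using measurable_sets[OF measurable_label(1)[of "[]" p], of "{k}"] by (simp add: vimage_def)
  have I [measurable]: "?I \<in> sets (brw_space p)"
    using measurable_sets[OF measurable_label(2)[of "[]" p], of "{a..<b}"] by (simp add: vimage_def)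
  have XA: "?X k \<inter> A = ?X k \<inter> A' k" for k
  proof -
    have "fun_upd \<omega> [] (k, 0) \<in> A \<longleftrightarrow> \<omega> \<in> A" if "fst (\<omega> []) = k" for \<omega>
      using irr[of \<omega> 0] that by simp
    then show ?thesis by (auto simp: A'_def)
  qed
  have det: "determined_by (- {[]}) (A' k)" for k
    unfolding determined_by_def A'_def
  proof (intro allI impI)
    fix \<omega> \<omega>' :: brw_sample assume "\<forall>i\<in>- {[]}. \<omega> i = \<omega>' i"
    then have "fun_upd \<omega> [] (k, 0) = fun_upd \<omega>' [] (k, 0)" by (auto simp: fun_eq_iff)
    then show "\<omega> \<in> {\<omega>. fun_upd \<omega> [] (k, 0) \<in> A} \<longleftrightarrow> \<omega>' \<in> {\<omega>. fun_upd \<omega> [] (k, 0) \<in> A}" by simp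
  qed
  have ind: "measure (brw_space p) (C \<inter> A' k) = measure (brw_space p) C * measure (brw_space p) (A' k)"
    if "C \<in> sets (brw_space p)" "determined_by {[]} C" for C k
    unfolding brw_space_def
    by (rule measure_Int_determined_by[OF prob_space_label, where S="{[]}"])
      (use that det in \<open>simp_all flip: brw_space_def\<close>)
  have k: "measure (brw_space p) (?X k \<inter> (?I \<inter> A)) = (b - a) * measure (brw_space p) (?X k \<inter> A)" for k
  proof -
    have "?X k \<inter> (?I \<inter> A) = (?X k \<inter> ?I) \<inter> A' k"
      using XA[of k] by blast
    also have "measure (brw_space p) \<dots> = measure (brw_space p) (?X k \<inter> ?I) * measure (brw_space p) (A' k)"
      by (rule ind) (auto simp: determined_by_def)
    also have "?X k \<inter> ?I = {\<omega>. fst (\<omega> []) = k \<and> snd (\<omega> []) \<in> {a..<b}}"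
      by auto
    also have "measure (brw_space p) \<dots> = pmf p k * (b - a)"
      using ab by (rule prob_offspring_step)
    also have "pmf p k = measure (brw_space p) (?X k)"
      using prob_offspring[of p "[]" "{k}"] by (simp add: measure_pmf_single)
    also have "measure (brw_space p) (?X k) * (b - a) * measure (brw_space p) (A' k)
        = (b - a) * measure (brw_space p) (?X k \<inter> A' k)"
      by (subst ind) (auto simp: determined_by_def)
    finally show ?thesis by (simp add: XA)
  qed
  have sums: "(\<lambda>k. measure (brw_space p) (?X k \<inter> C)) sums measure (brw_space p) C"
    if "C \<in> sets (brw_space p)" for C
  proof -
    have "(\<lambda>k. measure (brw_space p) (?X k \<inter> C)) sums measure (brw_space p) (\<Union>k. ?X k \<inter> C)"
      using that by (intro B.finite_measure_UNION) (auto simp: disjoint_family_on_def)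
    also have "(\<Union>k. ?X k \<inter> C) = C" by auto
    finally show ?thesis .
  qed
  have "(\<lambda>k. (b - a) * measure (brw_space p) (?X k \<inter> A)) sums measure (brw_space p) (?I \<inter> A)"
    unfolding k[symmetric] using A I by (intro sums) auto
  moreover have "(\<lambda>k. (b - a) * measure (brw_space p) (?X k \<inter> A)) sums ((b - a) * measure (brw_space p) A)"
    using sums[OF A] by (rule sums_mult)
  ultimately show ?thesis
    by (rule sums_unique2)
qed

text \<open>The unit interval splits into equal half-open pieces, one for each neighbour, and
  \<open>prob_first_step\<close> separates the choice of the piece from \<open>A y\<close>. The step
  is read from the root label because the lemma is meant for the shifted sample of a child.\<close>

lemma prob_step_ge:
  assumes fin: "finite (nbrs G x)" and A: "\<And>y. A y \<in> sets (brw_space p)"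
    and irr: "\<And>y \<omega> u. fun_upd \<omega> [] (fst (\<omega> []), u) \<in> A y \<longleftrightarrow> \<omega> \<in> A y"
  shows "avg G \<eta> (\<lambda>y. measure (brw_space p) (A y)) x
    \<le> measure (brw_space p) {\<omega>. coin \<eta> x (srw_step G x (snd (\<omega> []))) \<and> \<omega> \<in> A (srw_step G x (snd (\<omega> [])))}"
proof -
  interpret B: prob_space "brw_space p" by (rule prob_space_brw_space)
  let ?xs = "sorted_list_of_set (nbrs G x)" and ?d = "card (nbrs G x)"
  let ?D = "{\<omega>. coin \<eta> x (srw_step G x (snd (\<omega> []))) \<and> \<omega> \<in> A (srw_step G x (snd (\<omega> [])))}"
  let ?I = "\<lambda>j. {\<omega>. snd (\<omega> []) \<in> {j / ?d ..< (j + 1) / ?d}}"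
  let ?J = "{j. j < ?d \<and> coin \<eta> x (?xs ! j)}"
  have I: "?I j \<in> sets (brw_space p)" for j
    using measurable_sets[OF measurable_label(2)[of "[]" p], of "{j / ?d ..< (j + 1) / ?d}"] by (simp add: vimage_def)
  have bij: "bij_betw ((!) ?xs) ?J {y. G (x, y) \<and> coin \<eta> x y}"
  proof -
    have 1: "bij_betw ((!) ?xs) {..<?d} (nbrs G x)"
      using bij_betw_nth[of ?xs "{..<?d}" "nbrs G x"] fin by auto
    then have "bij_betw ((!) ?xs) ?J ((!) ?xs ` ?J)"
      by (auto simp: bij_betw_def intro: inj_on_subset)
    moreover have "(!) ?xs ` ?J = {y. G (x, y) \<and> coin \<eta> x y}"
      using 1 by (force simp: bij_betw_def nbrs_def)
    ultimately show ?thesis by simp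
  qed
  have "avg G \<eta> (\<lambda>y. measure (brw_space p) (A y)) x
      = (\<Sum>y | G (x, y) \<and> coin \<eta> x y. measure (brw_space p) (A y)) / ?d"
    using fin by (simp add: avg_finite)
  also have "\<dots> = (\<Sum>j\<in>?J. (1 / ?d) * measure (brw_space p) (A (?xs ! j)))"
    by (subst sum.reindex_bij_betw[OF bij, symmetric]) (simp add: sum_divide_distrib)
  also have "\<dots> = (\<Sum>j\<in>?J. measure (brw_space p) (?I j \<inter> A (?xs ! j)))"
  proof (rule sum.cong[OF refl])
    fix j assume j: "j \<in> ?J"
    have le: "0 \<le> j / ?d" "j / ?d \<le> (real j + 1) / ?d" "(real j + 1) / ?d \<le> 1"
      and len: "(real j + 1) / ?d - j / ?d = 1 / ?d"
      using j by (auto simp: divide_right_mono divide_le_eq diff_divide_distrib[symmetric])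
    show "(1 / ?d) * measure (brw_space p) (A (?xs ! j)) = measure (brw_space p) (?I j \<inter> A (?xs ! j))"
      using prob_first_step[OF A le irr, of "?xs ! j"] unfolding len by (rule sym)
  qed
  also have "\<dots> = measure (brw_space p) (\<Union>j\<in>?J. ?I j \<inter> A (?xs ! j))"
  proof (rule B.finite_measure_finite_Union[symmetric])
    have "j = k" if "\<omega> \<in> ?I j" "\<omega> \<in> ?I k" "j \<in> ?J" "k \<in> ?J" for j k \<omega>
    proof -
      have "j < k + 1" "k < j + 1"
        using that by (auto simp: divide_simps split: if_splits)
      then show ?thesis by simp
    qed
    then show "disjoint_family_on (\<lambda>j. ?I j \<inter> A (?xs ! j)) ?J"
      unfolding disjoint_family_on_def by blast
  qed (use A I in auto)
  also have "\<dots> \<le> measure (brw_space p) ?D"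
  proof (rule B.finite_measure_mono)
    show "(\<Union>j\<in>?J. ?I j \<inter> A (?xs ! j)) \<subseteq> ?D"
      using srw_step_eq[OF _ fin] by auto
    have [measurable]: "Measurable.pred (brw_space p) (\<lambda>\<omega>. \<omega> \<in> A y)" for y
      using A by simp
    have "Measurable.pred (brw_space p) (\<lambda>\<omega>. \<exists>y. srw_step G x (snd (\<omega> [])) = y \<and> coin \<eta> x y \<and> \<omega> \<in> A y)"
      by measurable
    then show "?D \<in> sets (brw_space p)"
      by (simp add: pred_def)
  qed
  finally show ?thesis .
qed

text \<open>Only the first two children are used. If no child succeeds, then up to probability
  \<open>0\<close> either there is one child and it fails, or there are at least two and the first
  two fail, independently of each other and of their number.\<close>

lemma prob_child_ge:
  assumes C [measurable]: "C \<in> sets (brw_space p)" and p0: "pmf p 0 = 0"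
  shows "survival_map (1 - pmf p 1) (measure (brw_space p) C)
    \<le> measure (brw_space p) {\<omega>. \<exists>i<fst (\<omega> []). shift i \<omega> \<in> C}"
proof -
  interpret B: prob_space "brw_space p" by (rule prob_space_brw_space)
  let ?S = "\<lambda>i. {\<omega>. shift i \<omega> \<notin> C}" and ?X = "\<lambda>A. {\<omega>. fst (\<omega> []) \<in> A}"
  let ?c = "measure (brw_space p) C"
  have X [measurable]: "?X A \<in> sets (brw_space p)" for A
    using measurable_sets[OF measurable_label(1)[of "[]" p], of A] by (simp add: vimage_def)
  have cC: "UNIV - C \<in> sets (brw_space p)"
    using sets.compl_sets[OF C] by (simp only: space_brw_space)
  have S [measurable]: "?S i \<in> sets (brw_space p)" for i
  proof -
    from measurable_sets[OF measurable_shift cC, of i] show ?thesis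
      by (simp add: vimage_def)
  qed
  have prob_S: "measure (brw_space p) (?S i) = 1 - ?c" for i
  proof -
    have "measure (brw_space p) (?S i) = measure (distr (brw_space p) (brw_space p) (shift i)) (space (brw_space p) - C)"
      using cC by (subst measure_distr) (simp_all add: vimage_def)
    also have "\<dots> = 1 - ?c"
      unfolding distr_shift using C by (rule B.prob_compl)
    finally show ?thesis .
  qed
  \<comment> \<open>The labels that end in \<open>i\<close> form disjoint blocks for different
    \<open>i\<close>, and none of them is the root label.\<close>
  have detS: "determined_by {w @ [i] | w. True} (?S i)" for i
    unfolding determined_by_def
  proof (intro allI impI)
    fix \<omega> \<omega>' :: brw_sample assume "\<forall>v\<in>{w @ [i] | w. True}. \<omega> v = \<omega>' v"
    then have "shift i \<omega> = shift i \<omega>'" by (auto simp: shift_def)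
    then show "\<omega> \<in> ?S i \<longleftrightarrow> \<omega>' \<in> ?S i" by simp
  qed
  have mono: "determined_by V A" if "determined_by U A" "U \<subseteq> V" for U V and A :: "brw_sample set"
    using that unfolding determined_by_def by blast
  have ind: "measure (brw_space p) (A \<inter> B) = measure (brw_space p) A * measure (brw_space p) B"
    if "A \<in> sets (brw_space p)" "B \<in> sets (brw_space p)" "determined_by U A" "determined_by (- U) B" for A B U
    using measure_Int_determined_by[OF prob_space_label, of A p U B] that unfolding brw_space_def by simp
  have detX: "determined_by {[]} (?X A)" for A
    by (auto simp: determined_by_def)
  have S01: "measure (brw_space p) (?S 0 \<inter> ?S 1) = (1 - ?c) * (1 - ?c)"
    using ind[OF S S detS mono[OF detS], of 1 0] by (auto simp: prob_S)
  have "determined_by (- {[]}) (?S 0 \<inter> ?S 1)"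
    using mono[OF detS[of 0], of "- {[]}"] mono[OF detS[of 1], of "- {[]}"]
    unfolding determined_by_def by auto
  then have P2: "measure (brw_space p) (?X {2..} \<inter> (?S 0 \<inter> ?S 1)) = measure (measure_pmf p) {2..} * ((1 - ?c) * (1 - ?c))"
    using ind[OF X sets.Int[OF S S] detX, of 0 1 "{2..}"] unfolding S01 prob_offspring by simp
  have P1: "measure (brw_space p) (?X {1} \<inter> ?S 0) = pmf p 1 * (1 - ?c)"
  proof -
    have "determined_by (- {[]}) (?S 0)"
      by (rule mono[OF detS]) auto
    then show ?thesis
      using ind[OF X S detX, of 0 "{1}"] unfolding prob_S prob_offspring by (simp add: measure_pmf_single)
  qed
  have P0: "measure (brw_space p) (?X {0}) = 0"
    using prob_offspring[of p "[]" "{0}"] p0 by (simp add: measure_pmf_single)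
  have p2: "measure (measure_pmf p) {2..} = 1 - pmf p 1"
  proof -
    have "measure (measure_pmf p) {2..} = 1 - measure (measure_pmf p) {0, 1}"
    proof -
      have "{2..} = UNIV - {0, 1 :: nat}" by auto
      then show ?thesis
        using measure_pmf.prob_compl[of "{0, 1}" p] by simp
    qed
    also have "measure (measure_pmf p) {0, 1} = pmf p 1"
      using p0 by (simp add: measure_measure_pmf_finite)
    finally show ?thesis .
  qed
  let ?E = "{\<omega>. \<exists>i<fst (\<omega> []). shift i \<omega> \<in> C}"
  have E: "?E \<in> sets (brw_space p)"
  proof -
    have [measurable]: "Measurable.pred (brw_space p) (\<lambda>\<omega>. shift i \<omega> \<in> C)" for i
      using C by measurable
    have "Measurable.pred (brw_space p) (\<lambda>\<omega>. \<exists>i. i < fst (\<omega> []) \<and> shift i \<omega> \<in> C)"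
      by measurable
    then show ?thesis by (simp add: pred_def)
  qed
  have "1 - measure (brw_space p) ?E = measure (brw_space p) (- ?E)"
    using B.prob_compl[OF E] by (simp add: Compl_eq_Diff_UNIV)
  also have "\<dots> \<le> measure (brw_space p) (?X {0} \<union> (?X {1} \<inter> ?S 0) \<union> (?X {2..} \<inter> (?S 0 \<inter> ?S 1)))"
  proof (rule B.finite_measure_mono)
    show "- ?E \<subseteq> ?X {0} \<union> (?X {1} \<inter> ?S 0) \<union> (?X {2..} \<inter> (?S 0 \<inter> ?S 1))"
    proof
      fix \<omega> assume w: "\<omega> \<in> - ?E"
      consider "fst (\<omega> []) = 0" | "fst (\<omega> []) = 1" | "2 \<le> fst (\<omega> [])" by linarith
      then show "\<omega> \<in> ?X {0} \<union> (?X {1} \<inter> ?S 0) \<union> (?X {2..} \<inter> (?S 0 \<inter> ?S 1))"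
        using w by cases auto
    qed
  qed measurable
  also have "\<dots> \<le> measure (brw_space p) (?X {0}) + measure (brw_space p) (?X {1} \<inter> ?S 0)
      + measure (brw_space p) (?X {2..} \<inter> (?S 0 \<inter> ?S 1))"
    by (intro order_trans[OF measure_Un_le] add_right_mono measure_Un_le sets.Un sets.Int X S)
  also have "\<dots> = pmf p 1 * (1 - ?c) + (1 - pmf p 1) * ((1 - ?c) * (1 - ?c))"
    unfolding P0 P1 P2 p2 by simp
  also have "\<dots> = 1 - survival_map (1 - pmf p 1) ?c"
    by (simp add: survival_map_def algebra_simps)
  finally show ?thesis by simp
qed

section \<open>Comparison of the iterations with the branching walk\<close>

context
  fixes p :: "nat pmf" and r :: real and G :: graph and D :: nat
  assumes p0: "pmf p 0 = 0" and r_def: "r = 1 - pmf p 1" and G: "bounded_degree_graph D G"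
begin

interpretation B: prob_space "brw_space p" by (rule prob_space_brw_space)

lemma r01: "0 \<le> r" "r \<le> 1"
  by (simp_all add: r_def pmf_le_1)

text \<open>For fixed coins, \<open>prob_step_ge\<close> turns the bound for \<open>n\<close>
  generations into one for a single child, and \<open>prob_child_ge\<close> combines the
  children.\<close>

lemma prob_alive_ge: "survival r n G \<eta> x \<le> measure (brw_space p) {\<omega>. alive G \<eta> n x \<omega>}"
proof (induction n arbitrary: x)
  case 0
  then show ?case using B.prob_space by simp
next
  case (Suc n)
  note S = unit_field_survival[OF r01]
  \<comment> \<open>An event of the shifted sample: its root label holds the step from
    \<open>x\<close> to the child.\<close>
  let ?C = "{\<omega>. coin \<eta> x (srw_step G x (snd (\<omega> []))) \<and> \<omega> \<in> {\<omega>'. alive G \<eta> n (srw_step G x (snd (\<omega> []))) \<omega>'}}"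
  have meas [measurable]: "Measurable.pred (brw_space p) (alive G \<eta> n y)" for y
    using measurable_compose[OF measurable_Pair2'[of \<eta>] measurable_alive[where p=p and G=G and n=n and x=y]] by simp
  have "Measurable.pred (brw_space p) (\<lambda>\<omega>. \<exists>y. srw_step G x (snd (\<omega> [])) = y \<and> coin \<eta> x y \<and> alive G \<eta> n y \<omega>)"
    by measurable
  then have C: "?C \<in> sets (brw_space p)"
    by (simp add: pred_def)
  have irr: "alive G \<eta> n y (fun_upd \<omega> [] (fst (\<omega> []), u)) \<longleftrightarrow> alive G \<eta> n y \<omega>" for y \<omega> u
    by (cases n) (auto simp: shift_def)
  have "avg G \<eta> (survival r n G \<eta>) x \<le> avg G \<eta> (\<lambda>y. measure (brw_space p) {\<omega>. alive G \<eta> n y \<omega>}) x"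
    using Suc by (intro avg_mono bounded_degree_graphD(2)[OF G] unit_fieldD[OF S])
  also have "\<dots> \<le> measure (brw_space p) ?C"
  proof (rule prob_step_ge[where A="\<lambda>y. {\<omega>. alive G \<eta> n y \<omega>}"])
    show "{\<omega>. alive G \<eta> n y \<omega>} \<in> sets (brw_space p)" for y
      using meas[of y] by (simp add: pred_def)
  qed (simp_all add: irr bounded_degree_graphD(2)[OF G])
  finally have "survival_map r (avg G \<eta> (survival r n G \<eta>) x) \<le> survival_map r (measure (brw_space p) ?C)"
    by (intro survival_map_mono r01 avg_nonneg B.prob_le_1)
  also have "\<dots> \<le> measure (brw_space p) {\<omega>. \<exists>i<fst (\<omega> []). shift i \<omega> \<in> ?C}"
    unfolding r_def using C p0 by (rule prob_child_ge)
  finally show ?case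
    by (simp add: survival.simps(2))
qed

text \<open>Under the joint law of walk and coins, \<open>mean_survival\<close> bounds from below
  the probability of being alive for \<open>n\<close> generations; these events decrease to survival
  forever. For a sample that is not good, survival forever implies percolation of the trace, which
  has probability \<open>0\<close> over the coins.\<close>

lemma prob_good_ge_mean_survival:
  "(INF n. mean_survival r q n G x) \<le> measure (brw_space p) {\<omega>. good q G x \<omega>}"
proof -
  interpret Q: prob_space "perc_space q" by (rule prob_space_perc_space)
  interpret P: prob_space "brw_space p \<Otimes>\<^sub>M perc_space q"
    by (rule prob_space_pair) (rule B.prob_space_axioms Q.prob_space_axioms)+
  interpret PP: pair_sigma_finite "brw_space p" "perc_space q" ..
  let ?P = "brw_space p \<Otimes>\<^sub>M perc_space q"
  let ?A = "\<lambda>n. {w. alive G (snd w) n x (fst w)}"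
  have A: "?A n \<in> sets ?P" for n
    using measurable_alive[where p=p and G=G and n=n and x=x] 
    by (simp add: pred_def space_pair_measure sets_perc_space cong: sets_pair_measure_cong)
  have slice: "Pair \<omega> -` {w. alive G (snd w) n x (fst w)} = {\<eta>. alive G \<eta> n x \<omega>}" 
    "(\<lambda>\<omega>. (\<omega>, \<eta>)) -` {w. alive G (snd w) n x (fst w)} = {\<omega>. alive G \<eta> n x \<omega>}" for \<omega> \<eta> n
    by auto
  have mean_le: "mean_survival r q n G x \<le> measure ?P (?A n)" for n
  proof -
    note S = unit_field_survival[OF r01]
    have "ennreal (mean_survival r q n G x) = (\<integral>\<^sup>+\<eta>. ennreal (survival r n G \<eta> x) \<partial>perc_space q)"
    proof -
      have "(\<lambda>\<eta>. survival r n G \<eta> x) \<in> borel_measurable graph_space"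
        using measurable_compose[OF measurable_Pair1' unit_fieldD(2)[OF S[of n], of x], of G] by simp
      then have "integrable (perc_space q) (\<lambda>\<eta>. survival r n G \<eta> x)"
        using unit_fieldD(3,4)[OF S] by (intro Q.integrable_const_bound[where B=1]) auto
      then show ?thesis
        unfolding mean_survival_def using unit_fieldD(3)[OF S] by (intro nn_integral_eq_integral[symmetric]) auto
    qed
    also have "\<dots> \<le> (\<integral>\<^sup>+\<eta>. emeasure (brw_space p) {\<omega>. alive G \<eta> n x \<omega>} \<partial>perc_space q)"
      using prob_alive_ge by (intro nn_integral_mono) (simp add: B.emeasure_eq_measure ennreal_leI)
    also have "\<dots> = emeasure ?P (?A n)"
      using PP.emeasure_pair_measure_alt2[OF A] by (simp add: slice)
    finally show ?thesis
      by (simp add: P.emeasure_eq_measure)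
  qed
  have "(\<lambda>n. measure ?P (?A n)) \<longlonglongrightarrow> measure ?P (\<Inter>n. ?A n)"
  proof (rule P.finite_Lim_measure_decseq)
    show "decseq ?A"
      using alive_Suc_imp by (intro decseq_SucI) blast
  qed (use A in blast)
  moreover have "(INF n. mean_survival r q n G x) \<le> measure ?P (?A n)" for n
    using unit_field_bdd(1)[of "\<lambda>n G \<eta>. mean_survival r q n G"] unit_field_mean_survival[OF r01]
    by (intro order_trans[OF _ mean_le] cINF_lower) auto
  ultimately have "(INF n. mean_survival r q n G x) \<le> measure ?P (\<Inter>n. ?A n)"
    by (intro LIMSEQ_le_const) auto
  also have "\<dots> \<le> measure ?P ({\<omega>. good q G x \<omega>} \<times> UNIV)"
  proof -
    \<comment> \<open>The exceptional set of survival forever without goodness; it is null because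
      each of its slices over a fixed walk is.\<close>
    let ?N = "(\<Inter>n. ?A n) - {\<omega>. good q G x \<omega>} \<times> UNIV"
    have g: "{\<omega>. good q G x \<omega>} \<in> sets (brw_space p)"
      using measurable_good[where p=p and q=q and G=G and x=x] by (simp add: pred_def)
    then have gU: "{\<omega>. good q G x \<omega>} \<times> UNIV \<in> sets ?P"
      using sets.top[of "perc_space q"] by (intro pair_measureI) auto
    have N: "?N \<in> sets ?P"
      using A gU by auto
    have "emeasure (perc_space q) (Pair \<omega> -` ?N) = 0" for \<omega>
    proof (cases "good q G x \<omega>")
      case False
      then have tr: "transient_from G x \<omega>" and "measure (perc_space q) (perc_event (trace_from G x \<omega>)) = 0"
        by (auto simp: good_def not_less measure_le_0_iff)
      then have "emeasure (perc_space q) (perc_event (trace_from G x \<omega>)) = 0"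
        by (simp add: Q.emeasure_eq_measure)
      moreover have "Pair \<omega> -` ?N \<subseteq> perc_event (trace_from G x \<omega>)"
      proof
        fix \<eta> assume "\<eta> \<in> Pair \<omega> -` ?N"
        then have "alive G \<eta> n x \<omega>" for n by simp
        then show "\<eta> \<in> perc_event (trace_from G x \<omega>)"
          by (rule alive_forever_percolates[OF tr])
      qed
      ultimately show ?thesis
        by (rule emeasure_eq_0[OF perc_event_sets])
    qed (auto simp: vimage_def)
    then have "emeasure ?P ?N = 0"
      by (subst Q.emeasure_pair_measure_alt[OF N]) simp
    then have "measure ?P ?N = 0"
      by (simp add: measure_def)
    moreover have "measure ?P (\<Inter>n. ?A n) \<le> measure ?P (({\<omega>. good q G x \<omega>} \<times> UNIV) \<union> ?N)"
      using A gU N by (intro P.finite_measure_mono) auto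
    moreover have "\<dots> \<le> measure ?P ({\<omega>. good q G x \<omega>} \<times> UNIV) + measure ?P ?N"
      using gU N by (rule measure_Un_le)
    ultimately show ?thesis by simp
  qed
  also have "\<dots> = measure (brw_space p) {\<omega>. good q G x \<omega>}"
    using Q.emeasure_pair_measure_Times[of "{\<omega>. good q G x \<omega>}" "brw_space p" UNIV]
      measurable_good[where p=p and q=q and G=G and x=x] sets.top[of "perc_space q"] Q.emeasure_space_1
    by (simp add: measure_def pred_def)
  finally show ?thesis .
qed

text \<open>One good child makes its parent good, whatever the coin of the edge between them; hence
  the recursion of \<open>goodness\<close> averages over all edges.\<close>

lemma prob_good_ge: "goodness r q n G x \<le> measure (brw_space p) {\<omega>. good q G x \<omega>}"
proof (induction n arbitrary: x)
  case 0
  then show ?case using prob_good_ge_mean_survival by simp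
next
  case (Suc n)
  note g = unit_field_goodness[OF r01, of q n]
  let ?C = "{\<omega>. coin all_open x (srw_step G x (snd (\<omega> []))) \<and> \<omega> \<in> {\<omega>'. good q G (srw_step G x (snd (\<omega> []))) \<omega>'}}"
  have "Measurable.pred (brw_space p) (\<lambda>\<omega>. \<exists>y. srw_step G x (snd (\<omega> [])) = y \<and> good q G y \<omega>)"
    by measurable
  then have C: "?C \<in> sets (brw_space p)"
    by (simp add: pred_def)
  have irr: "good q G y (fun_upd \<omega> [] (fst (\<omega> []), u)) \<longleftrightarrow> good q G y \<omega>" for y \<omega> u
    using root_step_irrelevant(3,4)[of "fun_upd \<omega> [] (fst (\<omega> []), u)" \<omega> G y] by (auto simp: good_def)
  have "avg G all_open (goodness r q n G) x \<le> avg G all_open (\<lambda>y. measure (brw_space p) {\<omega>. good q G y \<omega>}) x"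
    using Suc by (intro avg_mono bounded_degree_graphD(2)[OF G] unit_fieldD(3)[OF g])
  also have "\<dots> \<le> measure (brw_space p) ?C"
  proof (rule prob_step_ge[where A="\<lambda>y. {\<omega>. good q G y \<omega>}"])
    show "{\<omega>. good q G y \<omega>} \<in> sets (brw_space p)" for y
      using measurable_good[where p=p and q=q and G=G and x=y] by (simp add: pred_def)
  qed (simp_all add: irr bounded_degree_graphD(2)[OF G])
  finally have "survival_map r (avg G all_open (goodness r q n G) x) \<le> survival_map r (measure (brw_space p) ?C)"
    by (intro survival_map_mono r01 avg_nonneg B.prob_le_1)
  also have "\<dots> \<le> measure (brw_space p) {\<omega>. \<exists>i<fst (\<omega> []). shift i \<omega> \<in> ?C}"
    unfolding r_def using C p0 by (rule prob_child_ge)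
  also have "\<dots> \<le> measure (brw_space p) {\<omega>. good q G x \<omega>}"
    using good_shift measurable_good[where p=p and q=q and G=G and x=x] by (intro B.finite_measure_mono) (auto simp: pred_def)
  finally show ?case
    using Suc by simp
qed

lemma AE_good:
  assumes "limit_goodness r q G x = 1"
  shows "AE \<omega> in brw_space p. good q G x \<omega>"
proof -
  have "limit_goodness r q G x \<le> measure (brw_space p) {\<omega>. good q G x \<omega>}"
    unfolding limit_goodness_def using prob_good_ge by (intro cSUP_least) auto
  then have "measure (brw_space p) {\<omega>. good q G x \<omega>} = 1"
    using assms B.prob_le_1[of "{\<omega>. good q G x \<omega>}"] by (intro antisym) auto
  then show ?thesis
    by (auto dest: B.AE_prob_1)
qed

end

section \<open>Monotonicity of percolation and the critical probability\<close>

lemma perc_space_coupling: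
  assumes "0 \<le> q" "q \<le> q'" "q' \<le> 1" "0 < q'"
  shows "\<exists>M :: (nat \<times> nat \<Rightarrow> bool \<times> bool) measure.
    distr M (perc_space q') (\<lambda>\<zeta> e. fst (\<zeta> e)) = perc_space q' \<and>
    distr M (perc_space q) (\<lambda>\<zeta> e. fst (\<zeta> e) \<and> snd (\<zeta> e)) = perc_space q \<and>
    (\<lambda>\<zeta> e. fst (\<zeta> e)) \<in> M \<rightarrow>\<^sub>M perc_space q' \<and> (\<lambda>\<zeta> e. fst (\<zeta> e) \<and> snd (\<zeta> e)) \<in> M \<rightarrow>\<^sub>M perc_space q \<and> space M = UNIV \<and> finite_measure M"
proof -
  \<comment> \<open>Independent thinning: keeping an edge open at level \<open>q'\<close> with
    probability \<open>q / q'\<close> leaves it open with probability \<open>q\<close>.\<close>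
  define P where "P = pair_pmf (bernoulli_pmf q') (bernoulli_pmf (q / q'))"
  define M where "M = PiM (UNIV :: (nat \<times> nat) set) (\<lambda>_. measure_pmf P)"
  have fst: "map_pmf fst P = bernoulli_pmf q'"
    by (simp add: P_def map_fst_pair_pmf)
  have conj: "map_pmf (\<lambda>z. fst z \<and> snd z) P = bernoulli_pmf q"
  proof (rule pmf_eqI)
    have "(\<lambda>z. fst z \<and> snd z) -` {True} = {(True, True)}"
      by (simp add: vimage_def set_eq_iff)
    then have T: "pmf (map_pmf (\<lambda>z. fst z \<and> snd z) P) True = q"
      using assms by (simp add: pmf_map measure_pmf_single P_def pmf_pair)
    fix b show "pmf (map_pmf (\<lambda>z. fst z \<and> snd z) P) b = pmf (bernoulli_pmf q) b"
      using T assms by (cases b) (simp_all add: pmf_False_conv_True)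
  qed
  have d: "distr (measure_pmf P) (count_space UNIV) f = measure_pmf (map_pmf f P)" for f :: "bool \<times> bool \<Rightarrow> bool"
    by (simp add: map_pmf_rep_eq)
  have m: "(\<lambda>\<zeta> e. f (\<zeta> e)) \<in> M \<rightarrow>\<^sub>M perc_space q" for f :: "bool \<times> bool \<Rightarrow> bool" and q
    unfolding M_def perc_space_def by (rule measurable_PiM_single') (auto simp: space_PiM)
  have "distr M (perc_space s) (\<lambda>\<zeta> e. f (\<zeta> e)) = perc_space s"
    if "map_pmf f P = bernoulli_pmf s" for f s
    using distr_PiM_UNIV_map[OF prob_space_measure_pmf[of P], of f "count_space UNIV", where 'i="nat \<times> nat"]
    unfolding d that M_def perc_space_def by simp
  from this[OF fst] this[OF conj] m[of fst] m[of "\<lambda>z. fst z \<and> snd z"] show ?thesis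
    by (intro exI[of _ M])
      (auto simp: M_def space_PiM intro!: prob_space.finite_measure prob_space_PiM_UNIV prob_space_measure_pmf)
qed

text \<open>In the coupling every edge open at level \<open>q\<close> is also open at level
  \<open>q'\<close>, and opening more edges preserves an infinite cluster.\<close>

lemma perc_event_prob_mono:
  assumes "0 \<le> q" "q \<le> q'" "q' \<le> 1" "0 < q'"
  shows "measure (perc_space q) (perc_event H) \<le> measure (perc_space q') (perc_event H)"
proof -
  obtain M :: "(nat \<times> nat \<Rightarrow> bool \<times> bool) measure" where
    M: "distr M (perc_space q') (\<lambda>\<zeta> e. fst (\<zeta> e)) = perc_space q'"
      "distr M (perc_space q) (\<lambda>\<zeta> e. fst (\<zeta> e) \<and> snd (\<zeta> e)) = perc_space q"
    and m [measurable]: "(\<lambda>\<zeta> e. fst (\<zeta> e)) \<in> M \<rightarrow>\<^sub>M perc_space q'"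
      "(\<lambda>\<zeta> e. fst (\<zeta> e) \<and> snd (\<zeta> e)) \<in> M \<rightarrow>\<^sub>M perc_space q"
    and sp: "space M = UNIV" and fin: "finite_measure M"
    using perc_space_coupling[OF assms] by blast
  interpret finite_measure M by (rule fin)
  have inc: "\<eta> \<in> perc_event H \<Longrightarrow> (\<And>e. \<eta> e \<Longrightarrow> \<eta>' e) \<Longrightarrow> \<eta>' \<in> perc_event H" for \<eta> \<eta>'
  proof -
    assume "\<eta> \<in> perc_event H" and le: "\<And>e. \<eta> e \<Longrightarrow> \<eta>' e"
    then obtain x where "infinite {y. (x, y) \<in> (open_edges H \<eta>)\<^sup>*}"
      by (auto simp: perc_event_def)
    moreover have "(open_edges H \<eta>)\<^sup>* \<subseteq> (open_edges H \<eta>')\<^sup>*"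
      using le by (intro rtrancl_mono) (auto simp: open_edges_def)
    ultimately have "infinite {y. (x, y) \<in> (open_edges H \<eta>')\<^sup>*}"
      by (auto elim!: infinite_super[rotated])
    then show ?thesis
      by (auto simp: perc_event_def)
  qed
  have "measure (perc_space q) (perc_event H) = measure M ((\<lambda>\<zeta> e. fst (\<zeta> e) \<and> snd (\<zeta> e)) -` perc_event H \<inter> space M)"
    by (subst M(2)[symmetric]) (rule measure_distr[OF m(2) perc_event_sets])
  also have "\<dots> \<le> measure M ((\<lambda>\<zeta> e. fst (\<zeta> e)) -` perc_event H \<inter> space M)"
    by (intro finite_measure_mono measurable_sets[OF m(1)] perc_event_sets) (auto intro: inc)
  also have "\<dots> = measure (perc_space q') (perc_event H)"
    using measure_distr[OF m(1) perc_event_sets, of H] unfolding M(1) by simp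
  finally show ?thesis .
qed

text \<open>Almost surely all edges are closed and every cluster is a single vertex. This also makes
  the set defining \<open>p_c\<close> nonempty.\<close>

lemma perc_event_prob_0: "measure (perc_space 0) (perc_event H) = 0"
proof -
  have F: "\<forall>b\<in>set_pmf (bernoulli_pmf 0). \<not> b"
    by (auto simp: set_pmf_iff elim!: contrapos_np)
  have "AE \<eta> in perc_space 0. \<not> \<eta> e" for e
    unfolding perc_space_def
    using AE_PiM_component[of UNIV "\<lambda>_. measure_pmf (bernoulli_pmf 0)" e "\<lambda>b. \<not> b"] F
    unfolding AE_measure_pmf_iff by (blast intro: prob_space_measure_pmf)
  then have "AE \<eta> in perc_space 0. \<forall>e. \<not> \<eta> e"
    by (subst AE_all_countable) blast
  then have "AE \<eta> in perc_space 0. \<eta> \<notin> perc_event H"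
  proof eventually_elim
    case (elim \<eta>)
    then have "open_edges H \<eta> = {}" by (auto simp: open_edges_def)
    then show ?case by (simp add: perc_event_def)
  qed
  then show ?thesis
    by (subst (asm) AE_iff_measurable[OF perc_event_sets]) (auto simp: measure_def)
qed

text \<open>If a parameter \<open>s\<close> above \<open>q\<close> had percolation probability
  \<open>0\<close>, then by monotonicity so would \<open>q\<close>.\<close>

lemma p_c_le:
  assumes "0 \<le> q" "0 < measure (perc_space q) (perc_event H)"
  shows "p_c H \<le> q"
  unfolding p_c_def
proof (rule cSup_least)
  show "{s \<in> {0..1}. measure (perc_space s) (perc_event H) = 0} \<noteq> {}"
    using perc_event_prob_0[of H] by (auto intro!: exI[of _ 0])
  fix s assume s: "s \<in> {s \<in> {0..1}. measure (perc_space s) (perc_event H) = 0}"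
  show "s \<le> q"
  proof (rule ccontr)
    assume "\<not> s \<le> q"
    then show False
      using perc_event_prob_mono[of q s H] assms s by auto
  qed
qed

theorem theorem3p2:
  fixes \<mu> :: "graph measure" and p :: "nat pmf" and D :: nat
  assumes "prob_space \<mu>"
    and "sets \<mu> = sets graph_space"
    and "AE G in \<mu>. bounded_degree_graph D G"
    and "unimodular \<mu>"
    and "pmf p 0 = 0" and "pmf p 1 < 1"
    and "AE G in \<mu>. AE \<omega> in brw_space p. transient_sample G \<omega>"
  shows "AE G in \<mu>. AE \<omega> in brw_space p. p_c (trace G \<omega>) < 1"
proof -
  define r where "r = 1 - pmf p 1"
  \<comment> \<open>Any \<open>q\<close> below \<open>1\<close> with \<open>1 - q < r / 3\<close>
    serves; it depends on the offspring law only, so the resulting bound for \<open>p_c\<close> is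
    deterministic.\<close>
  define q where "q = 1 - r / 4"
  have r_pos: "0 < r" "r \<le> 1"
    using assms(6) by (auto simp: r_def)
  have q_less: "0 \<le> q" "q < 1" "1 - q < r / 3"
    using r_pos by (auto simp: q_def)
  interpret unimodular_random_graph \<mu> D q r
    using assms(1-4) r_pos q_less by (intro unimodular_random_graph.intro unimodular_random_graph_axioms.intro) auto
  have "AE G in \<mu>. limit_goodness r q G 0 = 1"
    using r_pos(1) q_less(3) by (rule limit_goodness_eq_1)
  then show ?thesis
    using assms(3,7)
  proof eventually_elim
    case (elim G)
    have "AE \<omega> in brw_space p. good q G 0 \<omega>"
      using assms(5) r_def elim(2,1) by (rule AE_good)
    with elim(3) show ?case
    proof eventually_elim
      case (elim \<omega>)
      \<comment> \<open>Transience of the sample discharges the premise in \<open>good\<close>,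
        which leaves a positive percolation probability at \<open>q\<close>.\<close>
      then have "p_c (trace G \<omega>) \<le> q"
        using q_less by (intro p_c_le) (auto simp: good_def transient_from_0 trace_from_0)
      with q_less show ?case by linarith
    qed
  qed
qed

end
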